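(* For every $\epsilon>0$ there is a constant $C(\epsilon)>0$, depending on $\epsilon$ alone, such that for every sequence of complex numbers $\{a_n\}$, every positive integer $Q$, and all integers $M,N$ with $N>0$, $$\sum_{q=1}^Q \frac{q}{\varphi (q)} \sum_{\chi \bmod q^2}^{\star} \left| \sum_{n=M+1}^{M+N} a_n \chi (n) \right|^2 \le C(\epsilon)\, \log (2Q) \left[ Q^3 + \left(N\sqrt{Q}+\sqrt{N}\,Q^2\right) N^{\epsilon} \right] \sum_{n=M+1}^{M+N} |a_n|^2 .$$
   Context: $\varphi$ is Euler's totient function. The symbol $\sum^{\star}_{\chi \bmod q^2}$ means that the sum runs over the primitive Dirichlet characters $\chi$ modulo $q^2$ only. *)

theory Defs
  imports Complex_Main "HOL-Number_Theory.Number_Theory"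
begin

text \<open>
  Characters are functions on all integers: the unit-group homomorphism extended by zero.
  The normalisation at 1 follows from multiplicativity and nonvanishing at 1.
\<close>
definition dirichlet_character :: "nat \<Rightarrow> (int \<Rightarrow> complex) \<Rightarrow> bool" where
  "dirichlet_character m \<chi> \<longleftrightarrow>
     (\<forall>a b. \<chi> (a * b) = \<chi> a * \<chi> b) \<and>
     (\<forall>a b. [a = b] (mod int m) \<longrightarrow> \<chi> a = \<chi> b) \<and>
     (\<forall>a. \<chi> a \<noteq> 0 \<longleftrightarrow> coprime a (int m))"

text \<open>
  Modulo 1, the constant character 1 is primitive.
\<close>
definition primitive_character :: "nat \<Rightarrow> (int \<Rightarrow> complex) \<Rightarrow> bool" where
  "primitive_character m \<chi> \<longleftrightarrow>
     dirichlet_character m \<chi> \<and>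
     \<not> (\<exists>d \<psi>. d dvd m \<and> d < m \<and> dirichlet_character d \<psi> \<and>
              (\<forall>n. coprime n (int m) \<longrightarrow> \<chi> n = \<psi> n))"

lemma dirichlet_character_values:
  assumes "dirichlet_character m \<chi>" "m > 0"
  shows "\<chi> a \<in> insert 0 {z. z ^ totient m = 1}"
proof (cases "coprime a (int m)")
  case True
  have mult: "\<chi> (x * y) = \<chi> x * \<chi> y" for x y
    using assms unfolding dirichlet_character_def by blast
  have "\<chi> 1 \<noteq> 0"
    using assms unfolding dirichlet_character_def by simp
  with mult[of 1 1] have one: "\<chi> 1 = 1" by simp
  have pow: "\<chi> (x ^ k) = \<chi> x ^ k" for x k
    by (induction k) (simp_all add: one mult)
  define b where "b = nat (a mod int m)"
  have b: "int b = a mod int m" using assms(2) by (simp add: b_def)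
  then have "coprime (int b) (int m)"
    using True assms(2) by (simp add: coprime_mod_left_iff)
  then have "[b ^ totient m = 1] (mod m)"
    by (intro euler_theorem) simp
  then have "[int (b ^ totient m) = int 1] (mod int m)"
    by (simp only: cong_int_iff)
  then have "\<chi> (int b ^ totient m) = \<chi> 1"
    using assms(1) unfolding dirichlet_character_def by (metis of_nat_1 of_nat_power)
  moreover have "\<chi> (int b) = \<chi> a"
    using assms(1) b unfolding dirichlet_character_def by (metis cong_mod_left cong_refl)
  ultimately show ?thesis by (simp add: pow one)
next
  case False
  with assms show ?thesis unfolding dirichlet_character_def by blast
qed

lemma finite_dirichlet_characters:
  assumes "m > 0"
  shows "finite {\<chi>. dirichlet_character m \<chi>}"
proof -
  let ?V = "insert 0 {z :: complex. z ^ totient m = 1}"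
  let ?r = "\<lambda>\<chi> :: int \<Rightarrow> complex. map (\<lambda>i. \<chi> (int i)) [0..<m]"
  have "finite ?V" using assms by (simp add: finite_roots_unity Suc_leI)
  then have fin: "finite {xs. set xs \<subseteq> ?V \<and> length xs = m}"
    by (rule finite_lists_length_eq)
  have "?r ` {\<chi>. dirichlet_character m \<chi>} \<subseteq> {xs. set xs \<subseteq> ?V \<and> length xs = m}"
    using dirichlet_character_values[OF _ assms] by fastforce
  then have "finite (?r ` {\<chi>. dirichlet_character m \<chi>})"
    using fin by (rule finite_subset)
  moreover have "inj_on ?r {\<chi>. dirichlet_character m \<chi>}"
  proof (rule inj_onI, rule ext)
    fix \<chi> \<psi> :: "int \<Rightarrow> complex" and a
    assume h: "\<chi> \<in> {\<chi>. dirichlet_character m \<chi>}" "\<psi> \<in> {\<chi>. dirichlet_character m \<chi>}"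
      and eq: "?r \<chi> = ?r \<psi>"
    define i where "i = nat (a mod int m)"
    have i: "int i = a mod int m" "i < m"
      using assms by (simp_all add: i_def nat_less_iff)
    have "\<chi> (int i) = \<psi> (int i)"
      using eq i(2) by (simp add: list_eq_iff_nth_eq)
    moreover have "[int i = a] (mod int m)" using i(1) by (simp add: cong_def)
    then have "\<chi> (int i) = \<chi> a" "\<psi> (int i) = \<psi> a"
      using h unfolding dirichlet_character_def by blast+
    ultimately show "\<chi> a = \<psi> a" by simp
  qed
  ultimately show ?thesis by (rule finite_imageD)
qed

lemma finite_primitive_characters:
  assumes "m > 0"
  shows "finite {\<chi>. primitive_character m \<chi>}"
  by (rule finite_subset[OF _ finite_dirichlet_characters[OF assms]])
    (auto simp: primitive_character_def)

end

theory Submission imports Defs "HOL-Analysis.Convex" begin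

text \<open>
  Gauss sums and Bessel's inequality reduce the sum over primitive characters to the values of
  \<open>S(x) = \<Sum> a\<^sub>n e(n x)\<close> at the reduced fractions \<open>u / q\<^sup>2\<close>, and the large sieve bounds these by
  \<open>K N \<Sum> |a\<^sub>n|\<^sup>2\<close>, where \<open>K\<close> is the largest number of these fractions in an interval of length
  \<open>1 / N\<close>. If \<open>Q\<^sup>2 \<ge> N\<close>, treating each \<open>q\<close> separately already gives \<open>Q\<^sup>3\<close>. Otherwise take
  \<open>q\<close> in a dyadic block. If \<open>u\<^sub>0 / q\<^sub>0\<^sup>2\<close> is one of the fractions in the interval, then \<open>u\<^sub>0 q\<^sup>2\<close> is
  within \<open>Q\<^sup>4 / N\<close> of \<open>0\<close> modulo \<open>q\<^sub>0\<^sup>2\<close> for every other one. Subtracting two such relations puts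
  \<open>n = x\<^sup>2 - y\<^sup>2 = (x - y) (x + y)\<close> into \<open>O(1 + Q\<^sup>4 / N)\<close> residue classes modulo \<open>q\<^sub>0\<^sup>2\<close>, so the divisor
  bound gives \<open>K\<^sup>2 \<le> K + O(N\<^sup>\<epsilon> (1 + Q\<^sup>4 / N))\<close>, that is \<open>K N = O(N\<^sup>\<epsilon> (N + \<surd>N Q\<^sup>2))\<close>. The
  logarithm counts the dyadic blocks.
\<close>

section \<open>The large sieve\<close>

definition ee :: "real \<Rightarrow> complex" where
  "ee x = cis (2 * pi * x)"

lemma norm_ee [simp]: "cmod (ee x) = 1"
  by (simp add: ee_def)

lemma ee_add: "ee (x + y) = ee x * ee y"
  by (simp add: ee_def cis_mult distrib_left)

lemma cnj_ee: "cnj (ee x) = ee (- x)"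
  by (simp add: ee_def cis_cnj)

lemma ee_of_int [simp]: "ee (of_int k) = 1"
  by (simp add: ee_def)

lemma ee_power: "ee x ^ k = ee (real k * x)"
  by (simp add: ee_def DeMoivre mult_ac)

lemma ee_eq_1_iff: "ee x = 1 \<longleftrightarrow> x \<in> \<int>"
proof
  assume "ee x = 1"
  then have "cos (2 * pi * x) = 1"
    by (simp add: ee_def complex_eq_iff)
  then obtain k where "2 * pi * x = of_int k * 2 * pi"
    using cos_one_2pi_int by blast
  then have "x = of_int k" by simp
  then show "x \<in> \<int>" by simp
qed (auto elim: Ints_cases)

lemma ee_int_div_cong:
  fixes x y :: int
  assumes "[x = y] (mod int m)"
  shows "ee (of_int x / real m) = ee (of_int y / real m)"
proof (cases "m = 0")
  case False
  from assms obtain k where "x = y + int m * k"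
    unfolding cong_iff_dvd_diff by (metis dvdE add_diff_cancel_left' diff_add_cancel add.commute)
  then have "real_of_int x / real m = of_int y / real m + of_int k"
    using False by (simp add: field_simps)
  then show ?thesis by (simp add: ee_add)
qed simp

text \<open>The left side is the length of a chord of the unit circle, which equals
  \<open>2 * \<bar>sin (pi * x)\<bar>\<close>.\<close>

lemma norm_ee_minus_1_le: "cmod (ee x - 1) \<le> 2 * pi * \<bar>x\<bar>"
proof -
  have "(cmod (ee x - 1))\<^sup>2 = (cos (2 * pi * x) - 1)\<^sup>2 + (sin (2 * pi * x))\<^sup>2"
    by (simp add: ee_def cmod_power2)
  also have "\<dots> = 2 - 2 * cos (2 * pi * x)"
    using sin_cos_squared_add[of "2 * pi * x"] by (simp add: power2_eq_square algebra_simps)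
  also have "\<dots> = (2 * sin (pi * x))\<^sup>2"
    using cos_double_sin[of "pi * x"] by (simp add: mult.assoc power_mult_distrib)
  finally have "cmod (ee x - 1) = \<bar>2 * sin (pi * x)\<bar>"
    by (metis abs_norm_cancel power2_eq_iff_nonneg abs_ge_zero power2_abs)
  also have "\<dots> \<le> 2 * \<bar>pi * x\<bar>"
    using abs_sin_x_le_abs_x[of "pi * x"] by (simp add: abs_mult)
  finally show ?thesis by (simp add: abs_mult)
qed

text \<open>This is a geometric sum whose ratio is an \<open>L\<close>-th root of unity; the ratio
  is 1 exactly when \<open>L\<close> divides \<open>z\<close>.\<close>

lemma sum_ee_roots:
  fixes z :: int
  assumes "L > 0"
  shows "(\<Sum>k<L. ee (of_int z * real k / real L)) = (if int L dvd z then of_nat L else 0)"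
proof -
  let ?w = "ee (of_int z / real L)"
  have eq: "(\<Sum>k<L. ee (of_int z * real k / real L)) = (\<Sum>k<L. ?w ^ k)"
    by (simp add: ee_power mult.commute)
  have w: "?w = 1 \<longleftrightarrow> int L dvd z"
  proof -
    have "real_of_int z / real L \<in> \<int> \<longleftrightarrow> int L dvd z"
      using assms of_int_div_of_int_in_Ints_iff[of z "int L", where 'a=real] by simp
    then show ?thesis by (simp add: ee_eq_1_iff)
  qed
  have "?w ^ L = 1" using assms by (simp add: ee_power)
  then show ?thesis
    using eq w by (simp add: sum_gp_strict)
qed

text \<open>Expanding the square and summing over \<open>k\<close> first leaves only pairs with
  \<open>x\<close> congruent to \<open>y\<close> modulo \<open>L\<close>, and injectivity reduces
  these to the diagonal.\<close>

lemma parseval_residues: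
  fixes b :: "int \<Rightarrow> complex"
  assumes L: "L > 0" and J: "finite J"
    and inj: "\<And>x y. x \<in> J \<Longrightarrow> y \<in> J \<Longrightarrow> [x = y] (mod int L) \<Longrightarrow> x = y"
  shows "(\<Sum>k<L. (cmod (\<Sum>n\<in>J. b n * ee (of_int n * real k / real L)))\<^sup>2)
       = real L * (\<Sum>n\<in>J. (cmod (b n))\<^sup>2)"
proof -
  have "ee (of_int x * real k / real L) * cnj (ee (of_int y * real k / real L))
     = ee (of_int (x - y) * real k / real L)" for x y k
    unfolding cnj_ee ee_add[symmetric] by (simp add: diff_divide_distrib left_diff_distrib)
  then have pt: "b x * ee (of_int x * real k / real L) * (cnj (b y) * cnj (ee (of_int y * real k / real L)))
     = b x * cnj (b y) * ee (of_int (x - y) * real k / real L)" for x y k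
    by (metis mult.assoc mult.left_commute)
  have "complex_of_real (\<Sum>k<L. (cmod (\<Sum>n\<in>J. b n * ee (of_int n * real k / real L)))\<^sup>2)
     = (\<Sum>k<L. \<Sum>x\<in>J. \<Sum>y\<in>J. b x * cnj (b y) * ee (of_int (x - y) * real k / real L))"
    by (simp only: of_real_sum complex_norm_square cnj_sum complex_cnj_mult sum_product pt)
  also have "\<dots> = (\<Sum>x\<in>J. \<Sum>y\<in>J. \<Sum>k<L. b x * cnj (b y) * ee (of_int (x - y) * real k / real L))"
    by (subst sum.swap, rule sum.cong[OF refl], rule sum.swap)
  also have "\<dots> = (\<Sum>x\<in>J. \<Sum>y\<in>J. if x = y then of_nat L * (b x * cnj (b x)) else 0)"
  proof (intro sum.cong refl)
    fix x y assume "x \<in> J" "y \<in> J"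
    then have "int L dvd x - y \<longleftrightarrow> x = y"
      using inj[of x y] by (auto simp: cong_iff_dvd_diff)
    then show "(\<Sum>k<L. b x * cnj (b y) * ee (of_int (x - y) * real k / real L))
       = (if x = y then of_nat L * (b x * cnj (b x)) else 0)"
      using L by (simp add: sum_distrib_left[symmetric] sum_ee_roots del: of_int_diff)
  qed
  also have "\<dots> = complex_of_real (real L * (\<Sum>n\<in>J. (cmod (b n))\<^sup>2))"
    using J by (simp add: sum_distrib_left complex_norm_square[symmetric] flip: of_real_power)
  finally show ?thesis by (simp only: of_real_eq_iff)
qed

text \<open>Summation by parts. When \<open>w\<close> is close to 1, the twisted sum costs little
  more than the untwisted one and its partial sums.\<close>

lemma abel_geometric_bound:
  fixes c :: "nat \<Rightarrow> complex"
  assumes "cmod w = 1"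
  shows "cmod (\<Sum>j<N. c j * w ^ j)
     \<le> cmod (\<Sum>j<N. c j) + cmod (w - 1) * (\<Sum>m=1..N. cmod (\<Sum>j<m. c j))"
proof -
  \<comment> \<open>Subtracting \<open>w ^ N\<close> times the full sum makes the induction close:
    passing to \<open>Suc N\<close> adds one term \<open>w ^ N * (w - 1)\<close> times a partial
    sum.\<close>
  have "cmod ((\<Sum>j<N. c j * w ^ j) - w ^ N * (\<Sum>j<N. c j))
      \<le> cmod (w - 1) * (\<Sum>m=1..N. cmod (\<Sum>j<m. c j))"
  proof (induction N)
    case (Suc N)
    have "(\<Sum>j<Suc N. c j * w ^ j) - w ^ Suc N * (\<Sum>j<Suc N. c j)
       = ((\<Sum>j<N. c j * w ^ j) - w ^ N * (\<Sum>j<N. c j)) - w ^ N * ((w - 1) * (\<Sum>j<Suc N. c j))"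
      by (simp add: algebra_simps)
    then have "cmod ((\<Sum>j<Suc N. c j * w ^ j) - w ^ Suc N * (\<Sum>j<Suc N. c j))
       \<le> cmod ((\<Sum>j<N. c j * w ^ j) - w ^ N * (\<Sum>j<N. c j))
          + cmod (w ^ N * ((w - 1) * (\<Sum>j<Suc N. c j)))"
      by (metis norm_triangle_ineq4)
    also have "cmod (w ^ N * ((w - 1) * (\<Sum>j<Suc N. c j)))
       = cmod (w - 1) * cmod (\<Sum>j<Suc N. c j)"
      using assms by (simp add: norm_mult norm_power)
    finally show ?case using Suc by (simp add: distrib_left)
  qed simp
  moreover have "cmod (w ^ N * (\<Sum>j<N. c j)) = cmod (\<Sum>j<N. c j)"
    using assms by (simp add: norm_mult norm_power)
  ultimately show ?thesis
    using norm_triangle_sub[of "\<Sum>j<N. c j * w ^ j" "w ^ N * (\<Sum>j<N. c j)"] by linarith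
qed

text \<open>The counting device is used twice: for sample points sharing a grid point in the large
  sieve, and for pairs \<open>(x, y)\<close> sharing a residue and a quotient in the spacing
  estimate.\<close>

lemma sum_comp_le_card_fibres:
  fixes F :: "'b \<Rightarrow> real"
  assumes "finite R" "finite T" "g ` R \<subseteq> T"
    and "\<And>k. k \<in> T \<Longrightarrow> F k \<ge> 0"
    and "\<And>k. k \<in> T \<Longrightarrow> real (card {r \<in> R. g r = k}) \<le> K"
  shows "(\<Sum>r\<in>R. F (g r)) \<le> K * (\<Sum>k\<in>T. F k)"
proof -
  have "(\<Sum>r\<in>R. F (g r)) = (\<Sum>k\<in>T. \<Sum>r | r \<in> R \<and> g r = k. F (g r))"
    using assms(1,2,3) by (intro sum.group[symmetric]) auto
  also have "\<dots> = (\<Sum>k\<in>T. real (card {r \<in> R. g r = k}) * F k)"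
    by (intro sum.cong refl) simp
  also have "\<dots> \<le> (\<Sum>k\<in>T. K * F k)"
    using assms(4,5) by (intro sum_mono mult_right_mono) auto
  finally show ?thesis by (simp add: sum_distrib_left)
qed

lemma sum_int_shift:
  fixes f :: "int \<Rightarrow> 'a :: comm_monoid_add"
  shows "(\<Sum>n = M + 1..M + int m. f n) = (\<Sum>j<m. f (M + 1 + int j))"
  by (rule sum.reindex_bij_witness[of _ "\<lambda>j. M + 1 + int j" "\<lambda>n. nat (n - M - 1)"]) auto

text \<open>
  A discrete form of Gallagher's argument: Abel summation replaces each point \<open>\<alpha> r\<close> by the
  grid point \<open>k / N\<close> to its left, and on the grid Parseval's identity is exact.
\<close>

theorem large_sieve:
  fixes a :: "int \<Rightarrow> complex" and \<alpha> :: "'r \<Rightarrow> real"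
  assumes N: "N > 0" and R: "finite R" and \<alpha>: "\<And>r. r \<in> R \<Longrightarrow> 0 \<le> \<alpha> r \<and> \<alpha> r < 1"
    and K: "\<And>k. real (card {r \<in> R. \<lfloor>real N * \<alpha> r\<rfloor> = k}) \<le> K"
  shows "(\<Sum>r\<in>R. (cmod (\<Sum>n = M + 1..M + int N. a n * ee (of_int n * \<alpha> r)))\<^sup>2)
     \<le> 2 * (1 + 4 * pi\<^sup>2) * K * real N * (\<Sum>n = M + 1..M + int N. (cmod (a n))\<^sup>2)"
proof -
  define g where "g r = nat \<lfloor>real N * \<alpha> r\<rfloor>" for r
  define P where "P m k = (cmod (\<Sum>n = M + 1..M + int m. a n * ee (of_int n * real k / real N)))\<^sup>2"
    for m k
  define Z where "Z = (\<Sum>n = M + 1..M + int N. (cmod (a n))\<^sup>2)"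
  \<comment> \<open>The weights come from squaring a two-term bound:
    \<open>(u + v)\<^sup>2 \<le> 2 u\<^sup>2 + 2 v\<^sup>2\<close> with
    \<open>v = 2 pi A / N\<close>, then Cauchy-Schwarz for \<open>A\<^sup>2\<close>, which costs a
    factor \<open>N\<close>.\<close>
  define F where "F k = 2 * P N k + 8 * pi\<^sup>2 / real N * (\<Sum>m=1..N. P m k)" for k
  have gr: "real (g r) \<le> real N * \<alpha> r" "real N * \<alpha> r < real (g r) + 1" "g r < N"
    and gi: "int (g r) = \<lfloor>real N * \<alpha> r\<rfloor>" if "r \<in> R" for r
  proof -
    have a: "0 \<le> real N * \<alpha> r" "real N * \<alpha> r < real N" using \<alpha>[OF that] N by auto
    show gi: "int (g r) = \<lfloor>real N * \<alpha> r\<rfloor>" using a by (simp add: g_def)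
    then have *: "real (g r) = of_int \<lfloor>real N * \<alpha> r\<rfloor>" by (metis of_int_of_nat_eq)
    show "real (g r) \<le> real N * \<alpha> r" "real N * \<alpha> r < real (g r) + 1" unfolding * by linarith+
    then show "g r < N" using a by linarith
  qed
  have pointwise: "(cmod (\<Sum>n = M + 1..M + int N. a n * ee (of_int n * \<alpha> r)))\<^sup>2 \<le> F (g r)"
    if r: "r \<in> R" for r
  proof -
    define \<theta> where "\<theta> = \<alpha> r - real (g r) / real N"
    define w where "w = ee \<theta>"
    define c where "c j = a (M + 1 + int j) * ee (of_int (M + 1 + int j) * real (g r) / real N)" for j
    define A where "A = (\<Sum>m=1..N. cmod (\<Sum>j<m. c j))"
    \<comment> \<open>The offset \<open>M + 1\<close> contributes only a phase of modulus 1, so the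
      geometric factor can start at exponent 0 and the bound does not depend on
      \<open>M\<close>.\<close>
    have "a (M + 1 + int j) * ee (of_int (M + 1 + int j) * \<alpha> r) = ee (of_int (M + 1) * \<theta>) * (c j * w ^ j)" for j
    proof -
      have "of_int (M + 1 + int j) * \<alpha> r = of_int (M + 1) * \<theta> + (of_int (M + 1 + int j) * real (g r) / real N + real j * \<theta>)"
        using N by (simp add: \<theta>_def field_simps)
      then show ?thesis by (simp only: ee_add c_def w_def ee_power mult_ac)
    qed
    then have "cmod (\<Sum>n = M + 1..M + int N. a n * ee (of_int n * \<alpha> r)) = cmod (\<Sum>j<N. c j * w ^ j)"
      by (simp only: sum_int_shift sum_distrib_left[symmetric] norm_mult norm_ee mult_1_left)
    also have "\<dots> \<le> cmod (\<Sum>j<N. c j) + cmod (w - 1) * A"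
      unfolding A_def by (rule abel_geometric_bound) (simp add: w_def)
    also have "\<dots> \<le> cmod (\<Sum>j<N. c j) + 2 * pi / real N * A"
    proof -
      have "\<theta> = (real N * \<alpha> r - real (g r)) / real N"
        using N by (simp add: \<theta>_def diff_divide_distrib)
      then have "\<bar>\<theta>\<bar> \<le> 1 / real N"
        using gr[OF r] by (simp add: divide_right_mono abs_divide)
      then have "2 * pi * \<bar>\<theta>\<bar> \<le> 2 * pi * (1 / real N)" by (intro mult_left_mono) auto
      then have "cmod (w - 1) \<le> 2 * pi / real N"
        using norm_ee_minus_1_le[of \<theta>] by (simp add: w_def)
      moreover have "0 \<le> A" by (simp add: A_def sum_nonneg)
      ultimately show ?thesis by (intro add_left_mono mult_right_mono)
    qed
    finally have "(cmod (\<Sum>n = M + 1..M + int N. a n * ee (of_int n * \<alpha> r)))\<^sup>2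
       \<le> (cmod (\<Sum>j<N. c j) + 2 * pi / real N * A)\<^sup>2"
      by (intro power_mono) auto
    also have "\<dots> \<le> 2 * (cmod (\<Sum>j<N. c j))\<^sup>2 + 2 * (2 * pi / real N * A)\<^sup>2"
      by (smt (verit, best) power2_sum sum_squares_bound)
    also have "\<dots> = 2 * (cmod (\<Sum>j<N. c j))\<^sup>2 + 8 * pi\<^sup>2 / (real N)\<^sup>2 * A\<^sup>2"
      by (simp add: power_mult_distrib power_divide)
    also have "\<dots> \<le> 2 * (cmod (\<Sum>j<N. c j))\<^sup>2
        + 8 * pi\<^sup>2 / (real N)\<^sup>2 * (real N * (\<Sum>m=1..N. (cmod (\<Sum>j<m. c j))\<^sup>2))"
    proof (intro add_left_mono mult_left_mono)
      show "A\<^sup>2 \<le> real N * (\<Sum>m=1..N. (cmod (\<Sum>j<m. c j))\<^sup>2)"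
        unfolding A_def using sum_squared_le_sum_of_squares[of "\<lambda>m. cmod (\<Sum>j<m. c j)" "{1..N}"]
        by (simp add: mult.commute)
    qed simp
    also have "\<dots> = F (g r)"
      using N by (simp add: F_def P_def c_def sum_int_shift power2_eq_square)
    finally show ?thesis .
  qed
  \<comment> \<open>At most \<open>N\<close> consecutive integers are distinct modulo
    \<open>N\<close>, so Parseval is exact for every truncation, not only for
    \<open>m = N\<close>.\<close>
  have P: "(\<Sum>k<N. P m k) \<le> real N * Z" if "m \<le> N" for m
  proof -
    have "(\<Sum>k<N. P m k) = real N * (\<Sum>n = M + 1..M + int m. (cmod (a n))\<^sup>2)"
      unfolding P_def
    proof (rule parseval_residues)
      fix x y assume xy: "x \<in> {M + 1..M + int m}" "y \<in> {M + 1..M + int m}" "[x = y] (mod int N)"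
      then have "int N dvd x - y" "\<bar>x - y\<bar> < int N"
        using that by (auto simp: cong_iff_dvd_diff)
      then show "x = y" using dvd_imp_le_int[of "x - y" "int N"] by fastforce
    qed (use N in auto)
    also have "\<dots> \<le> real N * Z"
      unfolding Z_def using that by (intro mult_left_mono sum_mono2) auto
    finally show ?thesis .
  qed
  have "(\<Sum>r\<in>R. (cmod (\<Sum>n = M + 1..M + int N. a n * ee (of_int n * \<alpha> r)))\<^sup>2) \<le> (\<Sum>r\<in>R. F (g r))"
    by (rule sum_mono) (rule pointwise)
  also have "\<dots> \<le> K * (\<Sum>k<N. F k)"
  proof (rule sum_comp_le_card_fibres[OF R])
    fix k
    have "{r \<in> R. g r = k} = {r \<in> R. \<lfloor>real N * \<alpha> r\<rfloor> = int k}"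
      using gi by fastforce
    then show "real (card {r \<in> R. g r = k}) \<le> K" using K by simp
    show "0 \<le> F k" by (simp add: F_def P_def sum_nonneg)
  qed (use gr in auto)
  also have "\<dots> \<le> K * (2 * (real N * Z) + 8 * pi\<^sup>2 / real N * (real N * (real N * Z)))"
  proof -
    have "(\<Sum>k<N. F k) = 2 * (\<Sum>k<N. P N k) + 8 * pi\<^sup>2 / real N * (\<Sum>m=1..N. \<Sum>k<N. P m k)"
      unfolding F_def sum.distrib sum_distrib_left[symmetric] by (subst sum.swap) (rule refl)
    moreover have "(\<Sum>m=1..N. \<Sum>k<N. P m k) \<le> of_nat (card {1..N}) * (real N * Z)"
      using P by (intro sum_bounded_above) auto
    ultimately have "(\<Sum>k<N. F k) \<le> 2 * (real N * Z) + 8 * pi\<^sup>2 / real N * (real N * (real N * Z))"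
      using P[OF order_refl] by (simp only:) (intro add_mono mult_left_mono; simp)
    moreover have "0 \<le> K" using K[of 0] by (meson of_nat_0_le_iff order_trans)
    ultimately show ?thesis by (intro mult_left_mono)
  qed
  also have "\<dots> = 2 * (1 + 4 * pi\<^sup>2) * K * real N * Z"
    using N by (simp add: algebra_simps)
  finally show ?thesis by (simp add: Z_def)
qed

section \<open>Primitive characters and Gauss sums\<close>

lemma dirichlet_character_mult: "dirichlet_character m \<chi> \<Longrightarrow> \<chi> (a * b) = \<chi> a * \<chi> b"
  by (simp add: dirichlet_character_def)

lemma dirichlet_character_cong:
  "dirichlet_character m \<chi> \<Longrightarrow> [a = b] (mod int m) \<Longrightarrow> \<chi> a = \<chi> b"
  by (simp add: dirichlet_character_def)

lemma dirichlet_character_eq_0_iff: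
  "dirichlet_character m \<chi> \<Longrightarrow> \<chi> a = 0 \<longleftrightarrow> \<not> coprime a (int m)"
  by (auto simp: dirichlet_character_def)

lemma dirichlet_character_1: "dirichlet_character m \<chi> \<Longrightarrow> \<chi> 1 = 1"
  using dirichlet_character_mult[of m \<chi> 1 1] dirichlet_character_eq_0_iff[of m \<chi> 1] by simp

lemma dirichlet_character_norm:
  assumes "dirichlet_character m \<chi>" "m > 0" "coprime a (int m)"
  shows "cmod (\<chi> a) = 1"
proof -
  have "\<chi> a \<noteq> 0" using assms by (simp add: dirichlet_character_eq_0_iff)
  then have "\<chi> a ^ totient m = 1"
    using dirichlet_character_values[OF assms(1,2), of a] by auto
  then have "cmod (\<chi> a) ^ totient m = 1" by (metis norm_one norm_power)
  then show ?thesis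
    using assms(2) by (metis norm_ge_zero power_eq_1_iff totient_gt_0_iff not_gr0 abs_of_nonneg real_norm_def)
qed

lemma dirichlet_character_mult_cnj:
  assumes "dirichlet_character m \<chi>" "m > 0" "coprime a (int m)"
  shows "\<chi> a * cnj (\<chi> a) = 1"
  using complex_norm_square[of "\<chi> a"] dirichlet_character_norm[OF assms] by simp

text \<open>Starting the range at 0 keeps the residue 0 for modulus 1, where it is a unit;
  \<open>totatives\<close> would represent that class by 1.\<close>

definition reduced_residues :: "nat \<Rightarrow> int set" where
  "reduced_residues m = {a \<in> {0..<int m}. coprime a (int m)}"

lemma finite_reduced_residues [simp]: "finite (reduced_residues m)"
  unfolding reduced_residues_def by (rule finite_subset[of _ "{0..<int m}"]) auto

lemma card_reduced_residues:
  assumes "m > 0"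
  shows "card (reduced_residues m) = totient m"
proof (cases "m = 1")
  case True
  then have "reduced_residues m = {0}" by (auto simp: reduced_residues_def)
  then show ?thesis using True by simp
next
  case False
  have "reduced_residues m = int ` totatives m"
  proof (intro equalityI subsetI)
    fix x assume x: "x \<in> reduced_residues m"
    then have "x \<noteq> 0" using False by (auto simp: reduced_residues_def)
    then have "nat x \<in> totatives m" "x = int (nat x)"
      using x coprime_int_iff[of "nat x" m] by (auto simp: reduced_residues_def in_totatives_iff)
    then show "x \<in> int ` totatives m" by (rule rev_image_eqI)
  next
    fix x assume "x \<in> int ` totatives m"
    then show "x \<in> reduced_residues m"
      using False assms totatives_less[of _ m] by (auto simp: reduced_residues_def in_totatives_iff)
  qed
  then show ?thesis by (simp add: totient_def card_image)
qed

text \<open>Multiplication by a unit permutes the residue classes, and \<open>f\<close> is a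
  function of the class.\<close>

lemma sum_residues_reindex:
  fixes f :: "int \<Rightarrow> complex"
  assumes m: "m > 0" and u: "coprime u (int m)"
    and f: "\<And>a b. [a = b] (mod int m) \<Longrightarrow> f a = f b"
  shows "(\<Sum>a\<in>{0..<int m}. f (u * a)) = (\<Sum>a\<in>{0..<int m}. f a)"
proof -
  have inj: "inj_on (\<lambda>a. (u * a) mod int m) {0..<int m}"
  proof (rule inj_onI)
    fix x y assume xy: "x \<in> {0..<int m}" "y \<in> {0..<int m}" "(u * x) mod int m = (u * y) mod int m"
    then have "[x = y] (mod int m)"
      using u cong_mult_lcancel[of u "int m" x y] by (simp add: cong_def)
    then show "x = y" using xy by (simp add: cong_def)
  qed
  moreover have "(\<lambda>a. (u * a) mod int m) ` {0..<int m} = {0..<int m}"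
    using m inj by (intro endo_inj_surj) auto
  ultimately have "(\<Sum>a\<in>{0..<int m}. f a) = (\<Sum>a\<in>{0..<int m}. f ((u * a) mod int m))"
    using sum.reindex[OF inj, of f] by simp
  also have "\<dots> = (\<Sum>a\<in>{0..<int m}. f (u * a))"
    by (intro sum.cong refl f) (simp add: cong_def)
  finally show ?thesis by simp
qed

lemma sum_dirichlet_character_restrict:
  assumes "dirichlet_character m \<chi>"
  shows "(\<Sum>a\<in>{0..<int m}. \<chi> a * f a) = (\<Sum>a\<in>reduced_residues m. \<chi> a * f a)"
    and "(\<Sum>a\<in>{0..<int m}. cnj (\<chi> a) * f a) = (\<Sum>a\<in>reduced_residues m. cnj (\<chi> a) * f a)"
  using assms
  by (intro sum.mono_neutral_right; auto simp: reduced_residues_def dirichlet_character_eq_0_iff)+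

lemma dirichlet_character_orthogonality:
  assumes \<chi>: "dirichlet_character m \<chi>" and \<psi>: "dirichlet_character m \<psi>" and m: "m > 0"
  shows "(\<Sum>a\<in>reduced_residues m. \<chi> a * cnj (\<psi> a)) = (if \<chi> = \<psi> then of_nat (totient m) else 0)"
proof (cases "\<chi> = \<psi>")
  case True
  then have "(\<Sum>a\<in>reduced_residues m. \<chi> a * cnj (\<psi> a)) = (\<Sum>a\<in>reduced_residues m. 1)"
    using dirichlet_character_mult_cnj[OF \<psi> m] by (intro sum.cong) (auto simp: reduced_residues_def)
  then show ?thesis using True m by (simp add: card_reduced_residues)
next
  case False
  then obtain u where u: "\<chi> u \<noteq> \<psi> u" by blast
  \<comment> \<open>Both characters vanish off the units, so a point where they differ is a
    unit.\<close>
  then have cop: "coprime u (int m)"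
    using dirichlet_character_eq_0_iff[OF \<chi>] dirichlet_character_eq_0_iff[OF \<psi>] by metis
  let ?S = "\<Sum>a\<in>{0..<int m}. \<chi> a * cnj (\<psi> a)"
  have "?S = (\<Sum>a\<in>{0..<int m}. \<chi> (u * a) * cnj (\<psi> (u * a)))"
    by (rule sum_residues_reindex[OF m cop, symmetric])
      (metis dirichlet_character_cong[OF \<chi>] dirichlet_character_cong[OF \<psi>])
  also have "\<dots> = \<chi> u * cnj (\<psi> u) * ?S"
    by (simp add: dirichlet_character_mult[OF \<chi>] dirichlet_character_mult[OF \<psi>] sum_distrib_left mult_ac)
  finally have "(1 - \<chi> u * cnj (\<psi> u)) * ?S = 0" by (simp add: algebra_simps)
  moreover have "\<chi> u * cnj (\<psi> u) \<noteq> 1"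
  proof
    assume "\<chi> u * cnj (\<psi> u) = 1"
    then have "\<chi> u * (\<psi> u * cnj (\<psi> u)) = \<psi> u" by (simp add: mult_ac)
    then show False using u dirichlet_character_mult_cnj[OF \<psi> m cop] by simp
  qed
  ultimately have "?S = 0" by simp
  then show ?thesis using False sum_dirichlet_character_restrict(1)[OF \<chi>] by simp
qed

text \<open>With \<open>g\<close> the combination of the \<open>h x\<close> weighted by the
  coefficients \<open>c x\<close>, the nonnegative sum of \<open>\<bar>P f - g\<bar>\<^sup>2\<close>
  expands to \<open>P\<close> times the right side minus the left side. Scaling \<open>f\<close> by
  \<open>P\<close> spares a normalisation of \<open>h\<close>.\<close>

lemma bessel_inequality:
  fixes h :: "'x \<Rightarrow> 'u \<Rightarrow> complex" and f :: "'u \<Rightarrow> complex"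
  assumes X: "finite X" and P: "P > 0"
    and orth: "\<And>x y. x \<in> X \<Longrightarrow> y \<in> X \<Longrightarrow>
      (\<Sum>a\<in>U. h x a * cnj (h y a)) = (if x = y then complex_of_real P else 0)"
  shows "(\<Sum>x\<in>X. (cmod (\<Sum>a\<in>U. cnj (h x a) * f a))\<^sup>2) \<le> P * (\<Sum>a\<in>U. (cmod (f a))\<^sup>2)"
proof -
  define c where "c x = (\<Sum>a\<in>U. cnj (h x a) * f a)" for x
  define g where "g a = (\<Sum>x\<in>X. c x * h x a)" for a
  define C where "C = (\<Sum>x\<in>X. (cmod (c x))\<^sup>2)"
  have C: "complex_of_real C = (\<Sum>x\<in>X. c x * cnj (c x))"
    by (simp only: C_def of_real_sum complex_norm_square)
  have fg: "(\<Sum>a\<in>U. f a * cnj (g a)) = complex_of_real C"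
  proof -
    have "(\<Sum>a\<in>U. f a * cnj (g a)) = (\<Sum>a\<in>U. \<Sum>x\<in>X. cnj (c x) * (cnj (h x a) * f a))"
      by (simp add: g_def sum_distrib_left mult_ac)
    also have "\<dots> = (\<Sum>x\<in>X. cnj (c x) * c x)"
      by (subst sum.swap) (simp add: c_def sum_distrib_left)
    finally show ?thesis by (simp add: C mult.commute)
  qed
  have gf: "(\<Sum>a\<in>U. g a * cnj (f a)) = complex_of_real C"
    using arg_cong[OF fg, of cnj] by (simp add: mult.commute)
  have gg: "(\<Sum>a\<in>U. g a * cnj (g a)) = complex_of_real (P * C)"
  proof -
    have "(\<Sum>a\<in>U. g a * cnj (g a))
       = (\<Sum>a\<in>U. \<Sum>x\<in>X. \<Sum>y\<in>X. c x * cnj (c y) * (h x a * cnj (h y a)))"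
      by (simp add: g_def sum_product mult_ac)
    also have "\<dots> = (\<Sum>x\<in>X. \<Sum>y\<in>X. c x * cnj (c y) * (\<Sum>a\<in>U. h x a * cnj (h y a)))"
      unfolding sum_distrib_left by (subst sum.swap, rule sum.cong[OF refl], rule sum.swap)
    also have "\<dots> = (\<Sum>x\<in>X. \<Sum>y\<in>X. if x = y then of_real P * (c x * cnj (c x)) else 0)"
      by (intro sum.cong refl) (simp add: orth)
    also have "\<dots> = of_real P * (\<Sum>x\<in>X. c x * cnj (c x))"
      using X by (simp add: sum_distrib_left)
    finally show ?thesis by (simp add: C)
  qed
  have "complex_of_real (\<Sum>a\<in>U. (cmod (of_real P * f a - g a))\<^sup>2)
     = of_real P ^ 2 * (\<Sum>a\<in>U. f a * cnj (f a)) - of_real P * (\<Sum>a\<in>U. f a * cnj (g a))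
       - of_real P * (\<Sum>a\<in>U. g a * cnj (f a)) + (\<Sum>a\<in>U. g a * cnj (g a))"
    unfolding of_real_sum complex_norm_square sum_distrib_left sum_subtractf[symmetric] sum.distrib[symmetric]
    by (intro sum.cong refl) (simp add: algebra_simps power2_eq_square)
  also have "\<dots> = complex_of_real (P * (P * (\<Sum>a\<in>U. (cmod (f a))\<^sup>2) - C))"
    unfolding fg gf gg by (simp add: complex_norm_square[symmetric] power2_eq_square algebra_simps flip: of_real_power)
  finally have "(\<Sum>a\<in>U. (cmod (of_real P * f a - g a))\<^sup>2) = P * (P * (\<Sum>a\<in>U. (cmod (f a))\<^sup>2) - C)"
    by (simp only: of_real_eq_iff)
  moreover have "0 \<le> (\<Sum>a\<in>U. (cmod (of_real P * f a - g a))\<^sup>2)" by (simp add: sum_nonneg)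
  ultimately have "0 \<le> P * (\<Sum>a\<in>U. (cmod (f a))\<^sup>2) - C"
    using P by (simp add: zero_le_mult_iff)
  then show ?thesis by (simp add: C_def c_def)
qed

lemma coprime_lift:
  fixes n d m :: int
  assumes "m \<noteq> 0" "coprime n d"
  obtains n' where "coprime n' m" "[n' = n] (mod d)"
proof -
  \<comment> \<open>Each prime of \<open>m\<close> then divides exactly one of \<open>n\<close> and
    \<open>k * d\<close>: if it divides \<open>n\<close>, it divides neither \<open>k\<close> nor
    \<open>d\<close>; otherwise it is a factor of \<open>k\<close>.\<close>
  define k where "k = \<Prod>{p \<in> prime_factors m. \<not> p dvd n}"
  have fin: "finite {p \<in> prime_factors m. \<not> p dvd n}" by simp
  have "coprime (n + k * d) m"
  proof (rule ccontr)
    assume "\<not> coprime (n + k * d) m"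
    then have "\<not> is_unit (gcd (n + k * d) m)" by (simp add: coprime_iff_gcd_eq_1)
    then obtain p where p: "prime p" "p dvd gcd (n + k * d) m"
      using assms(1) prime_divisorE[of "gcd (n + k * d) m"] by auto
    then have pm: "p \<in> prime_factors m" and pn: "p dvd n + k * d"
      using assms(1) by (auto simp: in_prime_factors_iff)
    show False
    proof (cases "p dvd n")
      case True
      then have "p dvd k * d" using pn by (simp add: dvd_add_right_iff)
      then have "p dvd k \<or> p dvd d" using p(1) by (simp add: prime_dvd_mult_iff)
      then show False
      proof
        assume "p dvd d"
        then show False using True assms(2) p(1) by (meson coprime_common_divisor not_prime_unit)
      next
        assume "p dvd k"
        then obtain p' where p': "p' \<in> prime_factors m" "\<not> p' dvd n" "p dvd p'"
          using p(1) fin unfolding k_def by (auto simp: prime_dvd_prod_iff)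
        then have "p = p'" using p(1) by (simp add: in_prime_factors_iff primes_dvd_imp_eq)
        then show False using True p' by simp
      qed
    next
      case False
      then have "p dvd k" unfolding k_def using pm by (intro dvd_prodI[OF fin, where f = "\<lambda>x. x"]) auto
      then show False using pn False by (simp add: dvd_add_left_iff)
    qed
  qed
  moreover have "[n + k * d = n] (mod d)" by (simp add: cong_def)
  ultimately show thesis by (rule that)
qed

text \<open>If \<open>\<chi>\<close> were trivial on all units congruent to 1 modulo
  \<open>d\<close>, it would depend only on the class modulo \<open>d\<close> and so agree on the
  units with a character modulo \<open>d\<close>, against primitivity.\<close>

lemma primitive_character_nontrivial_kernel:
  assumes \<chi>: "primitive_character m \<chi>" and m: "m > 0" and d: "d dvd m" "d < m"
  obtains u where "coprime u (int m)" "[u = 1] (mod int d)" "\<chi> u \<noteq> 1"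
proof -
  have "\<exists>u. coprime u (int m) \<and> [u = 1] (mod int d) \<and> \<chi> u \<noteq> 1"
  proof (rule ccontr)
    assume neg: "\<not> ?thesis"
    then have triv: "\<chi> u = 1" if "coprime u (int m)" "[u = 1] (mod int d)" for u
      using that by blast
    have dc: "dirichlet_character m \<chi>" using \<chi> by (simp add: primitive_character_def)
    have dm: "int d dvd int m" using d by simp
    \<comment> \<open>Multiplying by an inverse \<open>v\<close> of \<open>y\<close> modulo
      \<open>m\<close> turns \<open>x\<close> into a unit congruent to 1 modulo \<open>d\<close>,
      where \<open>\<chi>\<close> is trivial.\<close>
    have wd: "\<chi> x = \<chi> y" if xy: "coprime x (int m)" "coprime y (int m)" "[x = y] (mod int d)" for x y
    proof -
      obtain v where v: "[y * v = 1] (mod int m)" using xy(2) cong_solve_coprime_int by blast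
      then have cv: "coprime v (int m)" by (meson coprime_iff_invertible_int mult.commute cong_sym coprime_mult_left_iff cong_imp_coprime coprime_1_left)
      have "[x * v = y * v] (mod int d)" using xy(3) by (rule cong_scalar_right)
      also have "[y * v = 1] (mod int d)" using v dm by (rule cong_dvd_modulus)
      finally have "\<chi> (x * v) = 1" using triv xy(1) cv by simp
      moreover have "\<chi> (y * v) = 1"
        using dirichlet_character_cong[OF dc v] dirichlet_character_1[OF dc] by simp
      moreover have "\<chi> v \<noteq> 0" using cv dirichlet_character_eq_0_iff[OF dc] by simp
      ultimately show ?thesis
        unfolding dirichlet_character_mult[OF dc] by (metis mult_right_cancel)
    qed
    \<comment> \<open>A unit modulo \<open>d\<close> need not be a unit modulo \<open>m\<close>, so
      \<open>\<psi>\<close> evaluates \<open>\<chi>\<close> at a lifted representative;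
      \<open>wd\<close> makes the choice harmless.\<close>
    define L where "L n = (SOME n'. coprime n' (int m) \<and> [n' = n] (mod int d))" for n
    have L: "coprime (L n) (int m)" "[L n = n] (mod int d)" if "coprime n (int d)" for n
    proof -
      have "\<exists>n'. coprime n' (int m) \<and> [n' = n] (mod int d)"
        using coprime_lift[of "int m" n "int d"] that m by auto
      then show "coprime (L n) (int m)" "[L n = n] (mod int d)"
        unfolding L_def by (metis (mono_tags, lifting) someI_ex)+
    qed
    define \<psi> where "\<psi> n = (if coprime n (int d) then \<chi> (L n) else 0)" for n
    have "dirichlet_character d \<psi>"
      unfolding dirichlet_character_def
    proof (intro conjI allI impI)
      fix a b
      show "\<psi> (a * b) = \<psi> a * \<psi> b"
      proof (cases "coprime a (int d) \<and> coprime b (int d)")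
        case True
        then have "[L (a * b) = a * b] (mod int d)" "[L a * L b = a * b] (mod int d)"
          using L by (auto intro: cong_mult)
        then have "[L (a * b) = L a * L b] (mod int d)" by (metis cong_sym cong_trans)
        then have "\<chi> (L (a * b)) = \<chi> (L a * L b)" using True L by (intro wd) auto
        then show ?thesis using True by (simp add: \<psi>_def dirichlet_character_mult[OF dc])
      qed (auto simp: \<psi>_def)
    next
      fix a b assume ab: "[a = b] (mod int d)"
      then have iff: "coprime a (int d) \<longleftrightarrow> coprime b (int d)" by (meson cong_imp_coprime cong_sym)
      show "\<psi> a = \<psi> b"
      proof (cases "coprime a (int d)")
        case True
        then have "[L a = L b] (mod int d)" using iff L ab by (meson cong_sym cong_trans)
        then show ?thesis using True iff L by (auto simp: \<psi>_def intro: wd)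
      qed (use iff in \<open>simp add: \<psi>_def\<close>)
    next
      fix a show "\<psi> a \<noteq> 0 \<longleftrightarrow> coprime a (int d)"
        using L dirichlet_character_eq_0_iff[OF dc] by (auto simp: \<psi>_def)
    qed
    moreover have "\<chi> n = \<psi> n" if n: "coprime n (int m)" for n
    proof -
      have "coprime n (int d)" using n dm by (meson coprime_divisors dvd_refl)
      then show ?thesis using n L by (auto simp: \<psi>_def intro!: wd intro: cong_sym)
    qed
    ultimately show False using \<chi> d unfolding primitive_character_def by blast
  qed
  then show thesis using that by blast
qed

section \<open>Gauss sums of primitive characters\<close>

definition gauss_sum :: "nat \<Rightarrow> (int \<Rightarrow> complex) \<Rightarrow> complex" where
  "gauss_sum m \<chi> = (\<Sum>a\<in>{0..<int m}. cnj (\<chi> a) * ee (of_int a / real m))"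

text \<open>For a unit \<open>n\<close>, substitute \<open>n * a\<close> for \<open>a\<close>. For
  the other \<open>n\<close> the right side is 0, and the left side vanishes because a unit
  \<open>u\<close> with \<open>\<chi> u \<noteq> 1\<close> can be found that fixes \<open>n\<close>
  modulo \<open>m\<close>. The conjugate in \<open>gauss_sum\<close> makes \<open>\<chi> n\<close>
  itself appear.\<close>

lemma gauss_sum_separable:
  assumes \<chi>: "primitive_character m \<chi>" and m: "m > 0"
  shows "(\<Sum>a\<in>{0..<int m}. cnj (\<chi> a) * ee (of_int (a * n) / real m)) = \<chi> n * gauss_sum m \<chi>"
proof -
  have dc: "dirichlet_character m \<chi>" using \<chi> by (simp add: primitive_character_def)
  define G where "G k = (\<Sum>a\<in>{0..<int m}. cnj (\<chi> a) * ee (of_int (a * k) / real m))" for k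
  have shift: "G k = cnj (\<chi> u) * G (u * k)" if u: "coprime u (int m)" for u k
  proof -
    have "G k = (\<Sum>a\<in>{0..<int m}. cnj (\<chi> (u * a)) * ee (of_int (u * a * k) / real m))"
      unfolding G_def
    proof (rule sum_residues_reindex[OF m u, symmetric])
      fix a b assume ab: "[a = b] (mod int m)"
      then have "[a * k = b * k] (mod int m)" by (rule cong_scalar_right)
      then show "cnj (\<chi> a) * ee (of_int (a * k) / real m) = cnj (\<chi> b) * ee (of_int (b * k) / real m)"
        using dirichlet_character_cong[OF dc ab] ee_int_div_cong by metis
    qed
    also have "\<dots> = cnj (\<chi> u) * G (u * k)"
      by (simp add: G_def dirichlet_character_mult[OF dc] sum_distrib_left mult_ac)
    finally show ?thesis .
  qed
  have G_cong: "G k = G l" if "[k = l] (mod int m)" for k l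
    unfolding G_def using that
    by (intro sum.cong refl arg_cong2[of _ _ _ _ "(*)"] ee_int_div_cong cong_scalar_left)
  have "G n = \<chi> n * G 1"
  proof (cases "coprime n (int m)")
    case True
    then have "\<chi> n * G 1 = \<chi> n * cnj (\<chi> n) * G n" using shift[OF True, of 1] by (simp add: mult_ac)
    then show ?thesis using dirichlet_character_mult_cnj[OF dc m True] by simp
  next
    case False
    define g where "g = gcd n (int m)"
    define d where "d = nat (int m div g)"
    have "g \<noteq> 1" using False by (simp add: g_def coprime_iff_gcd_eq_1)
    moreover have "g > 0" using m by (simp add: g_def)
    ultimately have g: "g > 1" "g dvd int m" "g dvd n" by (simp, simp_all add: g_def)
    have dg: "int d * g = int m" using g by (simp add: d_def pos_imp_zdiv_nonneg_iff)
    then have "d dvd m" by (metis dvd_triv_left int_dvd_int_iff)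
    moreover have "d < m"
    proof -
      have "0 < int d * g" using dg m by simp
      then have "0 < int d" using g by (simp add: zero_less_mult_iff)
      then have "int d * 1 < int d * g" using g by (intro mult_strict_left_mono)
      then show ?thesis using dg by simp
    qed
    ultimately obtain u where u: "coprime u (int m)" "[u = 1] (mod int d)" "\<chi> u \<noteq> 1"
      using primitive_character_nontrivial_kernel[OF \<chi> m] by blast
    \<comment> \<open>Here \<open>d = m / g\<close> divides \<open>u - 1\<close> and
      \<open>g\<close> divides \<open>n\<close>, so \<open>u * n\<close> and \<open>n\<close> agree
      modulo \<open>m\<close>; \<open>shift\<close> then multiplies \<open>G n\<close> by a factor
      other than 1 without changing it.\<close>
    have "int d * g dvd (u - 1) * n"
      using u(2) g(3) by (intro mult_dvd_mono) (auto simp: cong_iff_dvd_diff)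
    then have "[u * n = n] (mod int m)" by (simp add: cong_iff_dvd_diff dg left_diff_distrib)
    then have "G n = cnj (\<chi> u) * G n" using shift[OF u(1)] G_cong by metis
    then have "(1 - cnj (\<chi> u)) * G n = 0" by (simp add: left_diff_distrib)
    moreover have "cnj (\<chi> u) \<noteq> 1" using u(3) by (metis complex_cnj_cnj complex_cnj_one)
    ultimately have "G n = 0" by simp
    then show ?thesis using False dirichlet_character_eq_0_iff[OF dc] by simp
  qed
  then show ?thesis by (simp add: G_def gauss_sum_def)
qed

lemma sum_norm_dirichlet_character:
  assumes "dirichlet_character m \<chi>" "m > 0"
  shows "(\<Sum>a\<in>{0..<int m}. (cmod (\<chi> a))\<^sup>2) = real (totient m)"
proof -
  have "complex_of_real (\<Sum>a\<in>{0..<int m}. (cmod (\<chi> a))\<^sup>2) = (\<Sum>a\<in>{0..<int m}. \<chi> a * cnj (\<chi> a))"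
    by (simp only: of_real_sum complex_norm_square)
  also have "\<dots> = complex_of_real (real (totient m))"
    using sum_dirichlet_character_restrict(1)[OF assms(1)] dirichlet_character_orthogonality[OF assms(1,1,2)]
    by simp
  finally show ?thesis by (simp only: of_real_eq_iff)
qed

text \<open>Parseval is applied to the additive transform of the conjugate of \<open>\<chi>\<close>.
  By separability that transform is \<open>\<chi>\<close> times the Gauss sum, and the common factor
  \<open>totient m\<close> cancels.\<close>

lemma norm_gauss_sum_primitive:
  assumes \<chi>: "primitive_character m \<chi>" and m: "m > 0"
  shows "(cmod (gauss_sum m \<chi>))\<^sup>2 = real m"
proof -
  have dc: "dirichlet_character m \<chi>" using \<chi> by (simp add: primitive_character_def)
  have "real m * (\<Sum>a\<in>{0..<int m}. (cmod (cnj (\<chi> a)))\<^sup>2)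
     = (\<Sum>k<m. (cmod (\<Sum>a\<in>{0..<int m}. cnj (\<chi> a) * ee (of_int a * real k / real m)))\<^sup>2)"
    by (rule parseval_residues[symmetric]) (use m in \<open>auto simp: cong_def\<close>)
  also have "\<dots> = (\<Sum>k<m. (cmod (\<chi> (int k)))\<^sup>2 * (cmod (gauss_sum m \<chi>))\<^sup>2)"
  proof (rule sum.cong[OF refl])
    fix k
    show "(cmod (\<Sum>a\<in>{0..<int m}. cnj (\<chi> a) * ee (of_int a * real k / real m)))\<^sup>2
       = (cmod (\<chi> (int k)))\<^sup>2 * (cmod (gauss_sum m \<chi>))\<^sup>2"
      using gauss_sum_separable[OF \<chi> m, of "int k"] by (simp add: norm_mult power_mult_distrib)
  qed
  also have "\<dots> = (\<Sum>a\<in>{0..<int m}. (cmod (\<chi> a))\<^sup>2) * (cmod (gauss_sum m \<chi>))\<^sup>2"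
    unfolding sum_distrib_right
    by (rule sum.reindex_bij_witness[of _ nat int]) auto
  finally have "real m * real (totient m) = real (totient m) * (cmod (gauss_sum m \<chi>))\<^sup>2"
    by (simp only: complex_mod_cnj sum_norm_dirichlet_character[OF dc m])
  then show ?thesis using m by simp
qed

text \<open>Multiplying the character sum by its Gauss sum, of squared modulus \<open>m\<close>,
  expresses it as a character coefficient of \<open>u \<mapsto> S u\<close>; Bessel over the units
  then has constant \<open>totient m\<close>.\<close>

lemma primitive_character_sum_le:
  fixes a :: "int \<Rightarrow> complex"
  assumes m: "m > 0"
  shows "real m * (\<Sum>\<chi> | primitive_character m \<chi>. (cmod (\<Sum>n\<in>J. a n * \<chi> n))\<^sup>2)
     \<le> real (totient m) *
       (\<Sum>u\<in>reduced_residues m. (cmod (\<Sum>n\<in>J. a n * ee (of_int n * (of_int u / real m))))\<^sup>2)"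
proof -
  define S where "S u = (\<Sum>n\<in>J. a n * ee (of_int n * (of_int u / real m)))" for u :: int
  have "real m * (\<Sum>\<chi> | primitive_character m \<chi>. (cmod (\<Sum>n\<in>J. a n * \<chi> n))\<^sup>2)
      = (\<Sum>\<chi> | primitive_character m \<chi>. (cmod (\<Sum>u\<in>reduced_residues m. cnj (\<chi> u) * S u))\<^sup>2)"
    unfolding sum_distrib_left
  proof (rule sum.cong[OF refl])
    fix \<chi> assume "\<chi> \<in> {\<chi>. primitive_character m \<chi>}"
    then have \<chi>: "primitive_character m \<chi>" by simp
    have dc: "dirichlet_character m \<chi>" using \<chi> by (simp add: primitive_character_def)
    have "(\<Sum>u\<in>reduced_residues m. cnj (\<chi> u) * S u) = (\<Sum>u\<in>{0..<int m}. cnj (\<chi> u) * S u)"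
      by (rule sum_dirichlet_character_restrict(2)[OF dc, symmetric])
    also have "\<dots> = (\<Sum>n\<in>J. a n * (\<Sum>u\<in>{0..<int m}. cnj (\<chi> u) * ee (of_int (u * n) / real m)))"
      unfolding S_def sum_distrib_left by (subst sum.swap) (simp add: mult_ac)
    also have "\<dots> = (\<Sum>n\<in>J. a n * \<chi> n) * gauss_sum m \<chi>"
      by (simp only: gauss_sum_separable[OF \<chi> m] sum_distrib_right mult.assoc)
    finally show "real m * (cmod (\<Sum>n\<in>J. a n * \<chi> n))\<^sup>2
       = (cmod (\<Sum>u\<in>reduced_residues m. cnj (\<chi> u) * S u))\<^sup>2"
      by (simp add: norm_mult power_mult_distrib norm_gauss_sum_primitive[OF \<chi> m])
  qed
  also have "\<dots> \<le> real (totient m) * (\<Sum>u\<in>reduced_residues m. (cmod (S u))\<^sup>2)"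
    by (rule bessel_inequality[where h = "\<lambda>\<chi>. \<chi>"])
      (use m finite_primitive_characters[OF m] in
        \<open>auto simp: primitive_character_def dirichlet_character_orthogonality\<close>)
  finally show ?thesis by (simp add: S_def)
qed

text \<open>The weight \<open>q / totient q\<close> is exactly what cancels the ratio
  \<open>totient (q\<^sup>2) / q\<^sup>2\<close>.\<close>

lemma primitive_character_square_sum_le:
  fixes a :: "int \<Rightarrow> complex"
  assumes q: "q > 0"
  shows "real q / real (totient q) *
      (\<Sum>\<chi> | primitive_character (q\<^sup>2) \<chi>. (cmod (\<Sum>n\<in>J. a n * \<chi> n))\<^sup>2)
     \<le> (\<Sum>u\<in>reduced_residues (q\<^sup>2). (cmod (\<Sum>n\<in>J. a n * ee (of_int n * (of_int u / real (q\<^sup>2)))))\<^sup>2)"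
proof -
  have "totient (q\<^sup>2) = q * totient q" by (simp add: totient_power)
  then show ?thesis
    using primitive_character_sum_le[of "q\<^sup>2" a J] q
    by (simp add: field_simps power2_eq_square)
qed

section \<open>The divisor bound\<close>

definition divisor_count :: "nat \<Rightarrow> nat" where
  "divisor_count n = card {d. d dvd n}"

text \<open>Every divisor of the product splits as a power \<open>p ^ i\<close> with
  \<open>i \<le> k\<close> times a divisor of \<open>m\<close>.\<close>

lemma divisor_count_prime_power_mult:
  fixes p m :: nat
  assumes p: "prime p" and m: "m > 0"
  shows "divisor_count (p ^ k * m) \<le> (k + 1) * divisor_count m"
proof -
  have "{d. d dvd p ^ k * m} \<subseteq> (\<lambda>(i, e). p ^ i * e) ` ({..k} \<times> {e. e dvd m})"
  proof
    fix d assume "d \<in> {d. d dvd p ^ k * m}"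
    then obtain x y where "d = x * y" "x dvd p ^ k" "y dvd m"
      using division_decomp by blast
    moreover from this obtain i where "i \<le> k" "x = p ^ i"
      using divides_primepow_nat[OF p] by blast
    ultimately show "d \<in> (\<lambda>(i, e). p ^ i * e) ` ({..k} \<times> {e. e dvd m})" by force
  qed
  moreover have "finite ({..k} \<times> {e. e dvd m})" using m by simp
  ultimately have "card {d. d dvd p ^ k * m} \<le> card ({..k} \<times> {e. e dvd m})"
    by (meson card_image_le card_mono finite_imageI order_trans)
  then show ?thesis by (simp add: divisor_count_def card_cartesian_product)
qed

lemma Suc_le_powr_of_large:
  fixes p \<epsilon> :: real
  assumes "\<epsilon> > 0" "p powr \<epsilon> \<ge> 2" "p > 0"
  shows "real (k + 1) \<le> (p ^ k) powr \<epsilon>"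
proof -
  have "real (k + 1) \<le> 2 ^ k"
    using of_nat_mono[OF Suc_leI[OF less_exp[of k]], where 'a=real] by simp
  also have "\<dots> \<le> (p powr \<epsilon>) ^ k" using assms by (intro power_mono) auto
  also have "\<dots> = (p ^ k) powr \<epsilon>"
    using assms by (simp add: powr_powr mult.commute flip: powr_realpow)
  finally show ?thesis .
qed

text \<open>The inequality \<open>1 + x \<le> exp x\<close> at
  \<open>x = \<epsilon> * ln 2 * k\<close> bounds both \<open>k\<close> and 1 by multiples of
  \<open>(2 ^ k) powr \<epsilon>\<close>. This serves the small primes, at the price of a
  constant.\<close>

lemma Suc_le_const_powr:
  fixes p \<epsilon> :: real
  assumes "\<epsilon> > 0" "p \<ge> 2"
  shows "real (k + 1) \<le> (1 + 1 / (\<epsilon> * ln 2)) * (p ^ k) powr \<epsilon>"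
proof -
  have e: "\<epsilon> * ln 2 > 0" using assms by simp
  have "1 + \<epsilon> * ln 2 * real k \<le> exp (\<epsilon> * ln 2 * real k)"
    by (rule exp_ge_add_one_self)
  also have "\<dots> = (2 ^ k) powr \<epsilon>" by (simp add: powr_def ln_realpow mult_ac)
  also have "\<dots> \<le> (p ^ k) powr \<epsilon>"
    using assms by (intro powr_mono2 power_mono) auto
  finally have *: "1 + \<epsilon> * ln 2 * real k \<le> (p ^ k) powr \<epsilon>" .
  then have "real k \<le> 1 / (\<epsilon> * ln 2) * (p ^ k) powr \<epsilon>"
    using e by (simp add: pos_le_divide_eq mult_ac)
  moreover have "1 \<le> (p ^ k) powr \<epsilon>" using * e by (smt (verit) mult_nonneg_nonneg of_nat_0_le_iff)
  ultimately show ?thesis by (simp add: distrib_right)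
qed

text \<open>Prime powers are stripped off one prime at a time. A prime with
  \<open>p powr \<epsilon> \<ge> 2\<close> costs no constant, the others cost a factor
  \<open>c\<close> each, and only finitely many are of the second kind.\<close>

lemma divisor_count_le_powr:
  fixes \<epsilon> :: real
  assumes \<epsilon>: "\<epsilon> > 0"
  obtains C where "C \<ge> 1" "\<And>n. n > 0 \<Longrightarrow> real (divisor_count n) \<le> C * real n powr \<epsilon>"
proof -
  define c where "c = 1 + 1 / (\<epsilon> * ln 2)"
  define B where "B = {p :: nat. real p powr \<epsilon> < 2}"
  have c: "c \<ge> 1" using \<epsilon> by (simp add: c_def)
  have "p < 2 powr (1 / \<epsilon>)" if "real p powr \<epsilon> < 2" for p :: nat
    using powr_less_mono2[OF _ _ that, of "1 / \<epsilon>"] \<epsilon> by (cases "p = 0") (auto simp: powr_powr)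
  then have "B \<subseteq> {..nat \<lceil>2 powr (1 / \<epsilon>)\<rceil>}"
    unfolding B_def by (auto simp: le_nat_iff) (meson le_ceiling_iff less_ceiling_iff linorder_not_less nat_ceiling_le_eq order_less_imp_le of_nat_le_iff order.trans real_nat_ceiling_ge)
  then have finB: "finite B" by (rule finite_subset) simp
  \<comment> \<open>The exponent counts only elements of \<open>B\<close> dividing \<open>n\<close>,
    so that it grows by at least one when a prime of \<open>B\<close> is restored in the
    induction.\<close>
  have main: "real (divisor_count n) \<le> c ^ card {p \<in> B. p dvd n} * real n powr \<epsilon>" if "n > 0" for n
    using that
  proof (induction n rule: less_induct)
    case (less n)
    show ?case
    proof (cases "n = 1")
      case True
      then have "{d. d dvd n} = {1}" by auto
      then have "real (divisor_count n) = 1" by (simp add: divisor_count_def)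
      then show ?thesis using True c by (simp add: one_le_power)
    next
      case False
      then obtain p where p: "prime p" "p dvd n" using prime_factor_nat by blast
      define k where "k = multiplicity p n"
      obtain m where nm: "n = p ^ k * m" and pm: "\<not> p dvd m"
        using multiplicity_decompose'[of n p] less.prems p(1) unfolding k_def
        by (metis not_prime_unit not_gr0)
      have k: "k > 0" using p less.prems unfolding k_def
        by (simp add: prime_multiplicity_gt_zero_iff)
      have m: "m > 0" using nm less.prems by (cases m) auto
      have "m < n" using nm m one_less_power[OF prime_gt_1_nat[OF p(1)] k] by simp
      then have IH: "real (divisor_count m) \<le> c ^ card {q \<in> B. q dvd m} * real m powr \<epsilon>"
        using less.IH m by blast
      have "real (k + 1) * c ^ card {q \<in> B. q dvd m}
          \<le> c ^ card {q \<in> B. q dvd n} * (real p ^ k) powr \<epsilon>"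
      proof (cases "p \<in> B")
        case True
        have "insert p {q \<in> B. q dvd m} \<subseteq> {q \<in> B. q dvd n}"
          using True p nm by auto
        then have "card (insert p {q \<in> B. q dvd m}) \<le> card {q \<in> B. q dvd n}"
          using finB by (intro card_mono) auto
        then have "Suc (card {q \<in> B. q dvd m}) \<le> card {q \<in> B. q dvd n}"
          using finB pm by simp
        then have "c * c ^ card {q \<in> B. q dvd m} \<le> c ^ card {q \<in> B. q dvd n}"
          using c power_increasing[of "Suc (card {q \<in> B. q dvd m})" _ c] by simp
        moreover have "real (k + 1) \<le> c * (real p ^ k) powr \<epsilon>"
          unfolding c_def using prime_ge_2_nat[OF p(1)] by (intro Suc_le_const_powr[OF \<epsilon>]) simp
        ultimately have "real (k + 1) * c ^ card {q \<in> B. q dvd m}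
           \<le> (c * (real p ^ k) powr \<epsilon>) * c ^ card {q \<in> B. q dvd m}"
          using c by (intro mult_right_mono) auto
        also have "\<dots> = (c * c ^ card {q \<in> B. q dvd m}) * (real p ^ k) powr \<epsilon>" by simp
        also have "\<dots> \<le> c ^ card {q \<in> B. q dvd n} * (real p ^ k) powr \<epsilon>"
          using \<open>c * c ^ card {q \<in> B. q dvd m} \<le> _\<close> by (intro mult_right_mono) auto
        finally show ?thesis .
      next
        case False
        then have "real (k + 1) \<le> (real p ^ k) powr \<epsilon>"
          using prime_gt_0_nat[OF p(1)] by (intro Suc_le_powr_of_large[OF \<epsilon>]) (auto simp: B_def)
        moreover have "c ^ card {q \<in> B. q dvd m} \<le> c ^ card {q \<in> B. q dvd n}"
          using c finB nm by (intro power_increasing card_mono) auto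
        ultimately have "c ^ card {q \<in> B. q dvd m} * real (k + 1)
            \<le> c ^ card {q \<in> B. q dvd n} * (real p ^ k) powr \<epsilon>"
          using c by (intro mult_mono) auto
        then show ?thesis by (simp add: mult.commute)
      qed
      then have "real (k + 1) * c ^ card {q \<in> B. q dvd m} * real m powr \<epsilon>
          \<le> c ^ card {q \<in> B. q dvd n} * (real p ^ k) powr \<epsilon> * real m powr \<epsilon>"
        by (intro mult_right_mono) auto
      also have "\<dots> = c ^ card {q \<in> B. q dvd n} * real n powr \<epsilon>"
        by (simp add: nm powr_mult)
      finally have "real (k + 1) * (c ^ card {q \<in> B. q dvd m} * real m powr \<epsilon>)
          \<le> c ^ card {q \<in> B. q dvd n} * real n powr \<epsilon>" by (simp only: mult.assoc)
      moreover have "real (divisor_count n) \<le> real (k + 1) * real (divisor_count m)"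
        using divisor_count_prime_power_mult[OF p(1) m, of k] nm
        by (metis of_nat_le_iff of_nat_mult)
      moreover have "real (k + 1) * real (divisor_count m)
          \<le> real (k + 1) * (c ^ card {q \<in> B. q dvd m} * real m powr \<epsilon>)"
        using IH by (intro mult_left_mono) auto
      ultimately show ?thesis by linarith
    qed
  qed
  show thesis
  proof
    show "c ^ card B \<ge> 1" using c by (simp add: one_le_power)
    fix n :: nat assume "n > 0"
    have "c ^ card {p \<in> B. p dvd n} \<le> c ^ card B"
      using c finB by (intro power_increasing card_mono) auto
    then show "real (divisor_count n) \<le> c ^ card B * real n powr \<epsilon>"
      using main[OF \<open>n > 0\<close>] by (meson mult_right_mono order_trans powr_ge_zero)
  qed
qed

section \<open>Spacing of fractions with square denominators\<close>

lemma card_int_diff_less: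
  fixes A :: "int set" and L :: real
  assumes L: "L \<ge> 0" and diff: "\<And>x y. x \<in> A \<Longrightarrow> y \<in> A \<Longrightarrow> \<bar>of_int x - of_int y\<bar> < L"
  shows "finite A" "real (card A) \<le> L + 1"
proof -
  have "finite A \<and> real (card A) \<le> L + 1"
  proof (cases "A = {}")
    case False
    then obtain z where z: "z \<in> A" by blast
    have "A \<subseteq> {z - \<lceil>L\<rceil>..z + \<lceil>L\<rceil>}"
    proof
      fix x assume "x \<in> A"
      then have "\<bar>real_of_int x - of_int z\<bar> < L" using diff z by blast
      then show "x \<in> {z - \<lceil>L\<rceil>..z + \<lceil>L\<rceil>}" by simp linarith
    qed
    then have fin: "finite A" by (rule finite_subset) simp
    have "card A \<le> card {Min A..Max A}" using fin by (intro card_mono) auto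
    then have "real (card A) \<le> of_int (Max A) - of_int (Min A) + 1"
      using Min_le[OF fin Max_in[OF fin False]] by simp
    also have "\<dots> \<le> L + 1"
      using diff[OF Max_in[OF fin False] Min_in[OF fin False]] by linarith
    finally show ?thesis using fin by blast
  qed (use L in simp)
  then show "finite A" "real (card A) \<le> L + 1" by auto
qed

text \<open>Equal floors put two fractions within \<open>1 / N\<close>, hence their numerators
  within \<open>q\<^sup>2 / N\<close>.\<close>

lemma card_reduced_residues_floor_le:
  assumes "q > 0" "N > 0"
  shows "real (card {u \<in> reduced_residues (q\<^sup>2). \<lfloor>real N * (of_int u / real (q\<^sup>2))\<rfloor> = k})
     \<le> real (q\<^sup>2) / real N + 1"
proof (rule card_int_diff_less(2))
  fix x y
  assume "x \<in> {u \<in> reduced_residues (q\<^sup>2). \<lfloor>real N * (of_int u / real (q\<^sup>2))\<rfloor> = k}"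
    and "y \<in> {u \<in> reduced_residues (q\<^sup>2). \<lfloor>real N * (of_int u / real (q\<^sup>2))\<rfloor> = k}"
  then have "\<lfloor>real N * (of_int x / real (q\<^sup>2))\<rfloor> = \<lfloor>real N * (of_int y / real (q\<^sup>2))\<rfloor>" by simp
  then have "\<bar>real N * (of_int x / real (q\<^sup>2)) - real N * (of_int y / real (q\<^sup>2))\<bar> < 1" by linarith
  also have "real N * (of_int x / real (q\<^sup>2)) - real N * (of_int y / real (q\<^sup>2))
      = (real N / real (q\<^sup>2)) * (of_int x - of_int y)"
    by (simp add: algebra_simps diff_divide_distrib)
  finally have "(real N / real (q\<^sup>2)) * \<bar>of_int x - of_int y\<bar> < 1" by (simp add: abs_mult)
  then show "\<bar>real_of_int x - of_int y\<bar> < real (q\<^sup>2) / real N"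
    using assms by (simp add: field_simps)
qed simp

text \<open>The square \<open>B \<times> B\<close> consists of the diagonal, the pairs with
  \<open>y < x\<close>, and their mirror images.\<close>

lemma card_square_le_pairs:
  fixes B :: "nat set"
  assumes "finite B"
  shows "card B * card B \<le> card B + 2 * card {(x, y) \<in> B \<times> B. y < x}"
proof -
  let ?P = "{(x, y) \<in> B \<times> B. y < x}"
  have fin: "finite ?P" by (rule finite_subset[OF _ finite_cartesian_product[OF assms assms]]) auto
  have "B \<times> B \<subseteq> (\<lambda>x. (x, x)) ` B \<union> (?P \<union> prod.swap ` ?P)"
    by (auto simp: image_iff)
  then have "card (B \<times> B) \<le> card ((\<lambda>x. (x, x)) ` B \<union> (?P \<union> prod.swap ` ?P))"
    using assms fin by (intro card_mono) auto
  also have "\<dots> \<le> card ((\<lambda>x. (x, x)) ` B) + (card ?P + card (prod.swap ` ?P))"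
    by (meson card_Un_le add_left_mono order_trans)
  also have "\<dots> \<le> card B + (card ?P + card ?P)"
    using assms fin by (intro add_mono card_image_le order_refl)
  finally show ?thesis by (simp only: card_cartesian_product mult_2)
qed

lemma sum_times_diff_nat:
  fixes x y :: nat
  shows "(x + y) * (x - y) = x\<^sup>2 - y\<^sup>2"
proof (cases "y \<le> x")
  case True
  then obtain k where "x = y + k" using le_Suc_ex by blast
  then show ?thesis by (simp add: power2_eq_square algebra_simps)
qed (simp add: power_mono)

text \<open>The divisor \<open>x + y\<close> of \<open>n\<close> fixes the cofactor
  \<open>x - y\<close>, and thereby the pair.\<close>

lemma card_difference_of_squares_le:
  assumes "n > 0"
  shows "card {(x, y). (y :: nat) < x \<and> x\<^sup>2 - y\<^sup>2 = n} \<le> divisor_count n"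
proof -
  let ?P = "{(x, y). (y :: nat) < x \<and> x\<^sup>2 - y\<^sup>2 = n}"
  have fac: "(x + y) * (x - y) = n" if "y < x" "x\<^sup>2 - y\<^sup>2 = n" for x y
    using that(2) by (simp add: sum_times_diff_nat)
  have "inj_on (\<lambda>(x, y). x + y) ?P"
  proof (rule inj_onI, clarify)
    fix x y x' y' :: nat
    assume h: "y < x" "y' < x'" "x + y = x' + y'" "n = x\<^sup>2 - y\<^sup>2" "x'\<^sup>2 - y'\<^sup>2 = x\<^sup>2 - y\<^sup>2"
    then have "(x + y) * (x - y) = (x + y) * (x' - y')"
      using fac[of y x] fac[of y' x'] by auto
    then have "x - y = x' - y'" using h by auto
    then show "x = x' \<and> y = y'" using h by linarith
  qed
  moreover have "(\<lambda>(x, y). x + y) ` ?P \<subseteq> {d. d dvd n}"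
  proof
    fix d assume "d \<in> (\<lambda>(x, y). x + y) ` ?P"
    then obtain x y where "y < x" "x\<^sup>2 - y\<^sup>2 = n" "d = x + y" by auto
    then show "d \<in> {d. d dvd n}" using fac[of y x] by (metis dvd_triv_left mem_Collect_eq)
  qed
  moreover have "finite {d. d dvd n}" using assms by simp
  ultimately show ?thesis unfolding divisor_count_def by (rule card_inj_on_le)
qed

text \<open>The denominators form a dyadic block, so any two of them differ by a factor below
  2.\<close>

definition square_farey_points :: "nat \<Rightarrow> (nat \<times> int) set" where
  "square_farey_points Q = (SIGMA q:{Q div 2<..Q}. reduced_residues (q\<^sup>2))"

lemma finite_square_farey_points [simp]: "finite (square_farey_points Q)"
  by (simp add: square_farey_points_def)

text \<open>
  In the proof \<open>g\<close> sends a pair to \<open>(m, n div q\<^sub>0\<^sup>2)\<close>, where \<open>m\<close> is a small integer with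
  \<open>u\<^sub>0 n + m \<equiv> 0 (mod q\<^sub>0\<^sup>2)\<close>; the two components determine \<open>n = x\<^sup>2 - y\<^sup>2\<close>.
\<close>

lemma card_square_farey_points_floor:
  fixes D :: real and k :: int
  assumes QN: "Q\<^sup>2 < N" and D: "D \<ge> 0" "\<And>n. 0 < n \<Longrightarrow> n < N \<Longrightarrow> real (divisor_count n) \<le> D"
  defines "X \<equiv> {r \<in> square_farey_points Q. \<lfloor>real N * (of_int (snd r) / real ((fst r)\<^sup>2))\<rfloor> = k}"
  shows "real (card X) * real (card X) \<le> real (card X) + 8 * D * (4 * real Q ^ 4 / real N + 1)"
proof (cases "X = {}")
  case False
  have N: "N > 0" using QN by linarith
  have fin: "finite X" by (simp add: X_def)
  have mem: "Q < 2 * q" "q \<le> Q" "q > 0" "coprime u (int (q\<^sup>2))" "\<lfloor>real N * (of_int u / real (q\<^sup>2))\<rfloor> = k"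
    if "(q, u) \<in> X" for q u
    using that by (auto simp: X_def square_farey_points_def reduced_residues_def)
  \<comment> \<open>Two members share the floor and so lie within \<open>1 / N\<close>; the
    denominators are then cleared.\<close>
  have close: "\<bar>of_int (u * int (q\<^sup>2) - v * int (p\<^sup>2))\<bar> < real (q\<^sup>2) * real (p\<^sup>2) / real N"
    if "(p, u) \<in> X" "(q, v) \<in> X" for p u q v
  proof -
    have pq: "p > 0" "q > 0" using mem[OF that(1)] mem[OF that(2)] by auto
    have "\<bar>real N * (of_int u / real (p\<^sup>2)) - real N * (of_int v / real (q\<^sup>2))\<bar> < 1"
      using mem(5)[OF that(1)] mem(5)[OF that(2)] by linarith
    also have "real N * (of_int u / real (p\<^sup>2)) - real N * (of_int v / real (q\<^sup>2))
       = real N / (real (q\<^sup>2) * real (p\<^sup>2)) * of_int (u * int (q\<^sup>2) - v * int (p\<^sup>2))"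
      using pq by (simp add: field_simps)
    finally have "real N / (real (q\<^sup>2) * real (p\<^sup>2)) * \<bar>of_int (u * int (q\<^sup>2) - v * int (p\<^sup>2))\<bar> < 1"
      by (simp add: abs_mult del: of_int_diff of_int_mult of_nat_power)
    then show ?thesis
      using N pq by (simp add: field_simps del: of_int_diff of_int_mult of_nat_power)
  qed
  \<comment> \<open>For a single denominator the numerators differ by less than
    \<open>q\<^sup>2 / N < 1\<close>, so \<open>X\<close> can be counted through its
    denominators.\<close>
  have inj: "inj_on fst X"
  proof (rule inj_onI)
    fix r s assume rs: "r \<in> X" "s \<in> X" "fst r = fst s"
    obtain q u v where r: "r = (q, u)" and s: "s = (q, v)" using rs(3) by (metis prod.collapse)
    have q: "q > 0" "q \<le> Q" using mem rs r by auto
    have "real (q\<^sup>2) < real N" using QN power_mono[OF q(2), of 2] by (simp only: of_nat_less_iff) linarith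
    have "\<bar>of_int (u * int (q\<^sup>2) - v * int (q\<^sup>2))\<bar> < real (q\<^sup>2) * real (q\<^sup>2) / real N"
      using close[of q u q v] rs r s by simp
    also have "of_int (u * int (q\<^sup>2) - v * int (q\<^sup>2)) = real (q\<^sup>2) * of_int (u - v)"
      by (simp add: algebra_simps)
    finally have "real (q\<^sup>2) * \<bar>of_int (u - v)\<bar> < real (q\<^sup>2) * (real (q\<^sup>2) / real N)"
      by (simp add: abs_mult del: of_int_diff)
    then have "\<bar>of_int (u - v)\<bar> < real (q\<^sup>2) / real N"
      using q by (simp only: mult_less_cancel_left_pos of_nat_0_less_iff zero_less_power)
    also have "\<dots> < 1" using \<open>real (q\<^sup>2) < real N\<close> N by simp
    finally show "r = s" using r s by simp
  qed
  define B where "B = fst ` X"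
  have finB: "finite B" and cardB: "card B = card X"
    using fin inj by (simp_all add: B_def card_image)
  have "\<forall>q\<in>B. \<exists>u. (q, u) \<in> X" by (force simp: B_def)
  then obtain A where A: "\<And>q. q \<in> B \<Longrightarrow> (q, A q) \<in> X" by metis
  obtain q0 where q0: "q0 \<in> B" using False by (auto simp: B_def)
  \<comment> \<open>This bounds the distance of \<open>A q0 * q\<^sup>2\<close> from the multiple
    \<open>A q * q0\<^sup>2\<close> of \<open>q0\<^sup>2\<close>, for every \<open>q\<close> in
    \<open>B\<close>; the difference of two such relations is below \<open>2 * T\<close>.\<close>
  define T where "T = real (Q\<^sup>2) * real (q0\<^sup>2) / real N"
  define P where "P = {(x, y) \<in> B \<times> B. y < x}"
  define m where "m = (\<lambda>(x, y). (A x - A y) * int (q0\<^sup>2) - A q0 * int (x\<^sup>2 - y\<^sup>2))"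
  define g where "g r = (m r, (case r of (x, y) \<Rightarrow> x\<^sup>2 - y\<^sup>2) div q0\<^sup>2)" for r
  \<comment> \<open>The quotient of \<open>x\<^sup>2 - y\<^sup>2\<close> by
    \<open>q0\<^sup>2\<close> is below 4 because \<open>x \<le> Q < 2 * q0\<close>.\<close>
  define V where "V = {i :: int. \<bar>of_int i\<bar> < 2 * T} \<times> {..<4 :: nat}"
  have q0': "q0 > 0" "Q < 2 * q0" "q0 \<le> Q" "coprime (A q0) (int (q0\<^sup>2))"
    using mem[OF A[OF q0]] by auto
  have T: "T \<ge> 0" "T \<le> real Q ^ 4 / real N"
  proof -
    show "T \<ge> 0" by (simp add: T_def)
    have "real (q0\<^sup>2) \<le> real (Q\<^sup>2)" using q0'(3) power_mono[of q0 Q 2] by (simp only: of_nat_le_iff)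
    then have "real (Q\<^sup>2) * real (q0\<^sup>2) \<le> real (Q\<^sup>2) * real (Q\<^sup>2)" by (intro mult_left_mono) auto
    also have "\<dots> = real Q ^ 4" by (simp add: power2_eq_square power4_eq_xxxx)
    finally show "T \<le> real Q ^ 4 / real N" unfolding T_def by (intro divide_right_mono) auto
  qed
  have small: "\<bar>of_int (A q * int (q0\<^sup>2) - A q0 * int (q\<^sup>2))\<bar> < T" if "q \<in> B" for q
  proof -
    have "real (q0\<^sup>2) * real (q\<^sup>2) / real N \<le> T"
    proof -
      have "real (q\<^sup>2) \<le> real (Q\<^sup>2)"
        using mem(2)[OF A[OF that]] power_mono[of q Q 2] by (simp only: of_nat_le_iff)
      then have "real (q0\<^sup>2) * real (q\<^sup>2) \<le> real (Q\<^sup>2) * real (q0\<^sup>2)"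
        by (subst mult.commute) (intro mult_right_mono, auto)
      then show ?thesis unfolding T_def by (intro divide_right_mono) auto
    qed
    then show ?thesis using close[OF A[OF that] A[OF q0]] by linarith
  qed
  have pair: "x \<in> B" "y \<in> B" "y < x" "y\<^sup>2 < x\<^sup>2" "x\<^sup>2 - y\<^sup>2 < N" "x\<^sup>2 - y\<^sup>2 < 4 * q0\<^sup>2"
    if "(x, y) \<in> P" for x y
  proof -
    show xy: "x \<in> B" "y \<in> B" "y < x" using that by (auto simp: P_def)
    then show "y\<^sup>2 < x\<^sup>2" by (simp add: power_strict_mono)
    have "x\<^sup>2 \<le> Q\<^sup>2" using mem(2)[OF A[OF xy(1)]] by (simp add: power_mono)
    moreover have "Q\<^sup>2 < 4 * q0\<^sup>2" using power_strict_mono[OF q0'(2), of 2] by (simp add: power_mult_distrib)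
    ultimately show "x\<^sup>2 - y\<^sup>2 < N" "x\<^sup>2 - y\<^sup>2 < 4 * q0\<^sup>2" using QN by linarith+
  qed
  \<comment> \<open>Since \<open>A q0\<close> is invertible modulo \<open>q0\<^sup>2\<close>, the
    first component of \<open>g\<close> fixes the residue of \<open>n\<close>; the second fixes the
    quotient.\<close>
  have determined: "x\<^sup>2 - y\<^sup>2 = x'\<^sup>2 - y'\<^sup>2" if "g (x, y) = g (x', y')" for x y x' y' :: nat
  proof -
    define n where "n = x\<^sup>2 - y\<^sup>2"
    define n' where "n' = x'\<^sup>2 - y'\<^sup>2"
    have "(A x - A y) * int (q0\<^sup>2) - A q0 * int n = (A x' - A y') * int (q0\<^sup>2) - A q0 * int n'"
      and d: "n div q0\<^sup>2 = n' div q0\<^sup>2"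
      using that by (simp_all add: g_def m_def n_def n'_def)
    then have "A q0 * (int n - int n') = ((A x - A y) - (A x' - A y')) * int (q0\<^sup>2)"
      by (simp add: algebra_simps)
    then have "int (q0\<^sup>2) dvd A q0 * (int n - int n')" by simp
    then have "int (q0\<^sup>2) dvd int n - int n'"
      using q0'(4) by (metis coprime_commute coprime_dvd_mult_right_iff)
    then have "[n = n'] (mod q0\<^sup>2)" by (metis cong_iff_dvd_diff cong_int_iff)
    then have "n = n'" using d by (metis cong_def div_mult_mod_eq)
    then show ?thesis by (simp add: n_def n'_def)
  qed
  \<comment> \<open>On a fibre the difference of squares is one number \<open>n\<close> with
    \<open>0 < n < N\<close>, so the divisor bound \<open>D\<close> controls its
    representations.\<close>
  have fibre: "real (card {r \<in> P. g r = v}) \<le> D" for v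
  proof (cases "{r \<in> P. g r = v} = {}")
    case False
    then obtain x y where xy: "(x, y) \<in> P" "g (x, y) = v" by auto
    define n where "n = x\<^sup>2 - y\<^sup>2"
    have n: "0 < n" "n < N" using pair[OF xy(1)] by (auto simp: n_def)
    let ?S = "{(x, y). (y :: nat) < x \<and> x\<^sup>2 - y\<^sup>2 = n}"
    have "card {r \<in> P. g r = v} \<le> card ?S"
    proof (rule card_mono)
      have "?S \<subseteq> {..n} \<times> {..n}"
      proof clarify
        fix x y :: nat assume xy: "y < x" "n = x\<^sup>2 - y\<^sup>2"
        have "x + y \<le> (x + y) * (x - y)" using xy(1) by simp
        also have "\<dots> = x\<^sup>2 - y\<^sup>2" by (rule sum_times_diff_nat)
        finally show "x \<in> {..x\<^sup>2 - y\<^sup>2} \<and> y \<in> {..x\<^sup>2 - y\<^sup>2}" by simp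
      qed
      then show "finite ?S" by (rule finite_subset) simp
      show "{r \<in> P. g r = v} \<subseteq> ?S"
      proof clarify
        fix x' y' assume h: "(x', y') \<in> P" "v = g (x', y')"
        then have "x'\<^sup>2 - y'\<^sup>2 = n" unfolding n_def by (intro determined) (simp add: xy)
        then show "y' < x' \<and> x'\<^sup>2 - y'\<^sup>2 = n" using pair(3)[OF h(1)] by simp
      qed
    qed
    also have "\<dots> \<le> divisor_count n" by (rule card_difference_of_squares_le[OF n(1)])
    finally show ?thesis using D(2)[OF n] by linarith
  qed (simp only: card.empty of_nat_0 D(1))
  have finP: "finite P"
    unfolding P_def by (rule finite_subset[OF _ finite_cartesian_product[OF finB finB]]) auto
  have "\<bar>real_of_int x - of_int y\<bar> < 4 * T"
    if "x \<in> {i :: int. \<bar>of_int i\<bar> < 2 * T}" "y \<in> {i :: int. \<bar>of_int i\<bar> < 2 * T}" for x y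
    using that unfolding mem_Collect_eq by linarith
  then have "finite {i :: int. \<bar>of_int i\<bar> < 2 * T}"
      "real (card {i :: int. \<bar>of_int i\<bar> < 2 * T}) \<le> 4 * T + 1"
    using T(1) card_int_diff_less[of "4 * T" "{i :: int. \<bar>of_int i\<bar> < 2 * T}"] by auto
  then have finV: "finite V" and cardV: "real (card V) \<le> (4 * T + 1) * 4"
    unfolding V_def by (simp_all add: card_cartesian_product)
  have "g ` P \<subseteq> V"
  proof clarify
    fix i j x y assume xy: "(x, y) \<in> P" and ij: "(i, j) = g (x, y)"
    have "i = (A x * int (q0\<^sup>2) - A q0 * int (x\<^sup>2)) - (A y * int (q0\<^sup>2) - A q0 * int (y\<^sup>2))"
    proof -
      have "int (x\<^sup>2 - y\<^sup>2) = int (x\<^sup>2) - int (y\<^sup>2)"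
        by (intro of_nat_diff less_imp_le pair(4)[OF xy])
      then show ?thesis
        using ij by (simp add: g_def m_def left_diff_distrib right_diff_distrib del: of_nat_power)
    qed
    then have "\<bar>of_int i\<bar> < 2 * T"
      using small[OF pair(1)[OF xy]] small[OF pair(2)[OF xy]] by linarith
    moreover have "j < 4"
      using ij pair(6)[OF xy] q0'(1) by (simp add: g_def less_mult_imp_div_less)
    ultimately show "(i, j) \<in> V" by (simp add: V_def)
  qed
  then have "(\<Sum>r\<in>P. (1 :: real)) \<le> D * (\<Sum>v\<in>V. 1)"
    using sum_comp_le_card_fibres[OF finP finV, of g "\<lambda>_. 1" D] fibre by simp
  also have "\<dots> \<le> D * ((4 * T + 1) * 4)" using cardV D(1) by (simp add: mult_left_mono)
  also have "\<dots> \<le> D * ((4 * (real Q ^ 4 / real N) + 1) * 4)"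
    using T(2) D(1) by (intro mult_left_mono mult_right_mono) auto
  finally have "real (card P) \<le> D * ((4 * (real Q ^ 4 / real N) + 1) * 4)" by simp
  moreover have "real (card X) * real (card X) \<le> real (card X) + 2 * real (card P)"
    using card_square_le_pairs[OF finB] unfolding P_def[symmetric] cardB
    by (metis (mono_tags) of_nat_add of_nat_le_iff of_nat_mult of_nat_numeral)
  \<comment> \<open>The factor 8 is 2 for the two orders of a pair times 4 for the possible
    quotients.\<close>
  moreover have "2 * (D * ((4 * (real Q ^ 4 / real N) + 1) * 4)) = 8 * D * (4 * real Q ^ 4 / real N + 1)"
    by (simp add: algebra_simps)
  ultimately show ?thesis by linarith
qed (use D in simp)

text \<open>The quadratic inequality for the number of points sharing a floor is solved for an
  explicit \<open>K\<close>, which is then fed to the large sieve.\<close>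

lemma square_farey_points_large_sieve:
  fixes a :: "int \<Rightarrow> complex"
  assumes QN: "Q\<^sup>2 < N" and D: "D \<ge> 1" "\<And>n. 0 < n \<Longrightarrow> n < N \<Longrightarrow> real (divisor_count n) \<le> D"
  shows "(\<Sum>r\<in>square_farey_points Q. (cmod (\<Sum>n = M + 1..M + int N.
       a n * ee (of_int n * (of_int (snd r) / real ((fst r)\<^sup>2)))))\<^sup>2)
     \<le> 16 * (1 + 4 * pi\<^sup>2) * D * (real N + sqrt (real N) * (real Q)\<^sup>2)
       * (\<Sum>n = M + 1..M + int N. (cmod (a n))\<^sup>2)"
proof -
  define K where "K = 4 * D * (2 * (real Q)\<^sup>2 / sqrt (real N) + 1)"
  have N: "N > 0" using QN by linarith
  have "real (card {r \<in> square_farey_points Q.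
      \<lfloor>real N * (of_int (snd r) / real ((fst r)\<^sup>2))\<rfloor> = k}) \<le> K" for k
  proof -
    define x where "x = real (card {r \<in> square_farey_points Q.
      \<lfloor>real N * (of_int (snd r) / real ((fst r)\<^sup>2))\<rfloor> = k})"
    \<comment> \<open>This \<open>t\<close> is chosen so that \<open>t * t\<close> is the term
      \<open>4 * Q ^ 4 / N\<close> of the counting bound.\<close>
    define t where "t = 2 * (real Q)\<^sup>2 / sqrt (real N)"
    have t: "t \<ge> 0" "t * t = 4 * real Q ^ 4 / real N"
      by (simp_all add: t_def power2_eq_square power4_eq_xxxx)
    have x: "x * x \<le> x + 8 * D * (t * t + 1)"
      using card_square_farey_points_floor[OF QN _ D(2), of k] D(1) by (simp add: x_def t)
    show ?thesis
    proof (rule ccontr)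
      assume "\<not> ?thesis"
      then have big: "x > 4 * D * (t + 1)" by (simp add: x_def K_def t_def)
      \<comment> \<open>As \<open>D * (t + 1)\<close> is at least 1, it absorbs the 1 in
        \<open>x - 1\<close>; then \<open>x * (x - 1)\<close> is at least
        \<open>12 * D\<^sup>2 * (t + 1)\<^sup>2\<close>, which exceeds the permitted
        \<open>8 * D * (t\<^sup>2 + 1)\<close>.\<close>
      have "1 * 1 \<le> D * (t + 1)" using D(1) t(1) by (intro mult_mono) auto
      then have "x - 1 > 3 * D * (t + 1)" using big by linarith
      then have "(4 * D * (t + 1)) * (3 * D * (t + 1)) \<le> x * (x - 1)"
        using big D(1) t(1) by (intro mult_mono) (auto simp: x_def)
      moreover have "8 * D * (t * t + 1) < (4 * D * (t + 1)) * (3 * D * (t + 1))"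
      proof -
        have "t * t + 1 \<le> (t + 1) * (t + 1)" using t(1) by (simp add: algebra_simps)
        then have "8 * D * (t * t + 1) \<le> 8 * D * ((t + 1) * (t + 1))"
          using D(1) by (intro mult_left_mono) auto
        also have "\<dots> < 12 * (D * D) * ((t + 1) * (t + 1))"
        proof (rule mult_strict_right_mono)
          have "D * 1 \<le> D * D" using D(1) by (intro mult_left_mono) auto
          then show "8 * D < 12 * (D * D)" using D(1) by linarith
        qed (use t(1) in auto)
        also have "\<dots> = (4 * D * (t + 1)) * (3 * D * (t + 1))" by (simp add: algebra_simps)
        finally show ?thesis .
      qed
      ultimately show False using x by (simp add: algebra_simps)
    qed
  qed
  then have "(\<Sum>r\<in>square_farey_points Q. (cmod (\<Sum>n = M + 1..M + int N.
       a n * ee (of_int n * (of_int (snd r) / real ((fst r)\<^sup>2)))))\<^sup>2)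
     \<le> 2 * (1 + 4 * pi\<^sup>2) * K * real N * (\<Sum>n = M + 1..M + int N. (cmod (a n))\<^sup>2)"
    by (intro large_sieve N finite_square_farey_points)
      (auto simp: square_farey_points_def reduced_residues_def divide_less_eq_1 simp flip: of_nat_power)
  also have "\<dots> \<le> 16 * (1 + 4 * pi\<^sup>2) * D * (real N + sqrt (real N) * (real Q)\<^sup>2)
       * (\<Sum>n = M + 1..M + int N. (cmod (a n))\<^sup>2)"
  proof (intro mult_right_mono sum_nonneg)
    have "K * real N = 4 * D * (2 * (sqrt (real N) * (real Q)\<^sup>2) + real N)"
    proof -
      have "K * real N = 4 * D * (2 * (real N / sqrt (real N) * (real Q)\<^sup>2) + real N)"
        by (simp add: K_def algebra_simps)
      then show ?thesis by (simp add: real_div_sqrt)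
    qed
    also have "\<dots> \<le> 4 * D * (2 * (real N + sqrt (real N) * (real Q)\<^sup>2))"
      using D(1) by (intro mult_left_mono) auto
    finally have "2 * (1 + 4 * pi\<^sup>2) * (K * real N)
        \<le> 2 * (1 + 4 * pi\<^sup>2) * (4 * D * (2 * (real N + sqrt (real N) * (real Q)\<^sup>2)))"
      by (intro mult_left_mono) auto
    then show "2 * (1 + 4 * pi\<^sup>2) * K * real N
        \<le> 16 * (1 + 4 * pi\<^sup>2) * D * (real N + sqrt (real N) * (real Q)\<^sup>2)"
      by (simp add: algebra_simps)
  qed auto
  finally show ?thesis .
qed

section \<open>Summation over the moduli\<close>

definition character_sum :: "(int \<Rightarrow> complex) \<Rightarrow> int set \<Rightarrow> nat \<Rightarrow> real" where
  "character_sum a J q = real q / real (totient q) *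
     (\<Sum>\<chi> | primitive_character (q\<^sup>2) \<chi>. (cmod (\<Sum>n\<in>J. a n * \<chi> n))\<^sup>2)"

lemma character_sum_single:
  fixes a :: "int \<Rightarrow> complex"
  assumes q: "q > 0" and N: "N > 0"
  shows "character_sum a {M + 1..M + int N} q
     \<le> 2 * (1 + 4 * pi\<^sup>2) * ((real q)\<^sup>2 + real N) * (\<Sum>n = M + 1..M + int N. (cmod (a n))\<^sup>2)"
proof -
  have "character_sum a {M + 1..M + int N} q \<le> (\<Sum>u\<in>reduced_residues (q\<^sup>2).
      (cmod (\<Sum>n = M + 1..M + int N. a n * ee (of_int n * (of_int u / real (q\<^sup>2)))))\<^sup>2)"
    unfolding character_sum_def by (rule primitive_character_square_sum_le[OF q])
  also have "\<dots> \<le> 2 * (1 + 4 * pi\<^sup>2) * (real (q\<^sup>2) / real N + 1) * real N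
      * (\<Sum>n = M + 1..M + int N. (cmod (a n))\<^sup>2)"
    using q by (intro large_sieve N card_reduced_residues_floor_le finite_reduced_residues)
      (auto simp: reduced_residues_def divide_less_eq_1 simp flip: of_nat_power)
  also have "\<dots> = 2 * (1 + 4 * pi\<^sup>2) * ((real q)\<^sup>2 + real N)
      * (\<Sum>n = M + 1..M + int N. (cmod (a n))\<^sup>2)"
  proof -
    have "(real (q\<^sup>2) / real N + 1) * real N = (real q)\<^sup>2 + real N" using N by (simp add: distrib_right)
    from this[symmetric] show ?thesis by (simp only: mult.assoc)
  qed
  finally show ?thesis .
qed

lemma character_sum_dyadic:
  fixes a :: "int \<Rightarrow> complex"
  assumes QN: "Q\<^sup>2 < N" and D: "D \<ge> 1" "\<And>n. 0 < n \<Longrightarrow> n < N \<Longrightarrow> real (divisor_count n) \<le> D"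
  shows "(\<Sum>q\<in>{Q div 2<..Q}. character_sum a {M + 1..M + int N} q)
     \<le> 16 * (1 + 4 * pi\<^sup>2) * D * (real N + sqrt (real N) * (real Q)\<^sup>2)
       * (\<Sum>n = M + 1..M + int N. (cmod (a n))\<^sup>2)"
proof -
  have "(\<Sum>q\<in>{Q div 2<..Q}. character_sum a {M + 1..M + int N} q)
     \<le> (\<Sum>q\<in>{Q div 2<..Q}. \<Sum>u\<in>reduced_residues (q\<^sup>2).
      (cmod (\<Sum>n = M + 1..M + int N. a n * ee (of_int n * (of_int u / real (q\<^sup>2)))))\<^sup>2)"
    unfolding character_sum_def by (intro sum_mono primitive_character_square_sum_le) auto
  also have "\<dots> = (\<Sum>r\<in>square_farey_points Q. (cmod (\<Sum>n = M + 1..M + int N.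
       a n * ee (of_int n * (of_int (snd r) / real ((fst r)\<^sup>2)))))\<^sup>2)"
    unfolding square_farey_points_def by (subst sum.Sigma) (auto simp: case_prod_beta)
  also have "\<dots> \<le> 16 * (1 + 4 * pi\<^sup>2) * D * (real N + sqrt (real N) * (real Q)\<^sup>2)
       * (\<Sum>n = M + 1..M + int N. (cmod (a n))\<^sup>2)"
    using assms by (rule square_farey_points_large_sieve)
  finally show ?thesis .
qed

text \<open>When \<open>N \<le> Q\<^sup>2\<close>, each of the \<open>Q\<close> moduli contributes
  at most a constant times \<open>Q\<^sup>2\<close>, with no interaction between different
  moduli.\<close>

lemma character_sum_large_modulus:
  fixes a :: "int \<Rightarrow> complex"
  assumes QN: "N \<le> Q\<^sup>2" and N: "N > 0"
  shows "(\<Sum>q = 1..Q. character_sum a {M + 1..M + int N} q)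
     \<le> 4 * (1 + 4 * pi\<^sup>2) * real Q ^ 3 * (\<Sum>n = M + 1..M + int N. (cmod (a n))\<^sup>2)"
proof -
  define Z where "Z = (\<Sum>n = M + 1..M + int N. (cmod (a n))\<^sup>2)"
  have Z: "Z \<ge> 0" by (simp add: Z_def sum_nonneg)
  have "(\<Sum>q = 1..Q. character_sum a {M + 1..M + int N} q)
     \<le> of_nat (card {1..Q}) * (4 * (1 + 4 * pi\<^sup>2) * (real Q)\<^sup>2 * Z)"
  proof (rule sum_bounded_above)
    fix q assume q: "q \<in> {1..Q}"
    have "real N \<le> (real Q)\<^sup>2" using QN by (metis of_nat_le_iff of_nat_power)
    moreover have "(real q)\<^sup>2 \<le> (real Q)\<^sup>2" using q by (intro power_mono) auto
    ultimately have "(real q)\<^sup>2 + real N \<le> 2 * (real Q)\<^sup>2" by linarith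
    then have "2 * (1 + 4 * pi\<^sup>2) * ((real q)\<^sup>2 + real N) * Z
        \<le> 2 * (1 + 4 * pi\<^sup>2) * (2 * (real Q)\<^sup>2) * Z"
      using Z by (intro mult_right_mono mult_left_mono) auto
    moreover have "character_sum a {M + 1..M + int N} q \<le> 2 * (1 + 4 * pi\<^sup>2) * ((real q)\<^sup>2 + real N) * Z"
      unfolding Z_def using q N by (intro character_sum_single) auto
    moreover have "2 * (1 + 4 * pi\<^sup>2) * (2 * (real Q)\<^sup>2) * Z = 4 * (1 + 4 * pi\<^sup>2) * (real Q)\<^sup>2 * Z"
      by (simp add: algebra_simps)
    ultimately show "character_sum a {M + 1..M + int N} q \<le> 4 * (1 + 4 * pi\<^sup>2) * (real Q)\<^sup>2 * Z"
      by linarith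
  qed
  then show ?thesis by (simp add: Z_def power3_eq_cube power2_eq_square mult_ac)
qed

text \<open>Induction by halving \<open>Q\<close>. The division by \<open>ln 2\<close> in the
  constant makes one dyadic block cost \<open>c * ln 2\<close>, the increment from
  \<open>ln Q\<close> to \<open>ln (2 * Q)\<close>. The bound \<open>D\<close> depends on
  \<open>N\<close> alone and so survives the halving.\<close>

lemma character_sum_small_modulus:
  fixes a :: "int \<Rightarrow> complex"
  assumes QN: "Q\<^sup>2 < N" and D: "D \<ge> 1" "\<And>n. 0 < n \<Longrightarrow> n < N \<Longrightarrow> real (divisor_count n) \<le> D"
    and Q: "Q > 0"
  shows "(\<Sum>q = 1..Q. character_sum a {M + 1..M + int N} q)
     \<le> 16 * (1 + 4 * pi\<^sup>2) / ln 2 * D * ln (2 * real Q) * (real N + sqrt (real N) * (real Q)\<^sup>2)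
       * (\<Sum>n = M + 1..M + int N. (cmod (a n))\<^sup>2)"
  using QN Q
proof (induction Q rule: less_induct)
  case (less Q)
  define Z where "Z = (\<Sum>n = M + 1..M + int N. (cmod (a n))\<^sup>2)"
  define c where "c = 16 * (1 + 4 * pi\<^sup>2) / ln 2 * D"
  define G where "G q = real N + sqrt (real N) * (real q)\<^sup>2" for q
  have c: "c \<ge> 0" using D by (simp add: c_def)
  have Z: "Z \<ge> 0" by (simp add: Z_def sum_nonneg)
  have G: "G q \<ge> 0" for q by (simp add: G_def)
  have block: "(\<Sum>q\<in>{Q div 2<..Q}. character_sum a {M + 1..M + int N} q) \<le> c * ln 2 * G Q * Z"
    using character_sum_dyadic[OF less.prems(1) D, of a M] by (simp add: Z_def c_def G_def)
  show ?case
  \<comment> \<open>At \<open>Q = 1\<close> the block is the whole range, and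
    \<open>ln (2 * Q)\<close> equals \<open>ln 2\<close>; halving would reach the excluded value
    0.\<close>
  proof (cases "Q = 1")
    case True
    then have "{Q div 2<..Q} = {1..Q}" by auto
    then show ?thesis using block True by (simp add: Z_def c_def G_def)
  next
    case False
    define R where "R = Q div 2"
    have R: "R > 0" "R < Q" "2 * R \<le> Q" using False less.prems(2) by (auto simp: R_def)
    have "R\<^sup>2 \<le> Q\<^sup>2" using R by (intro power_mono) auto
    then have RN: "R\<^sup>2 < N" using less.prems(1) by linarith
    have "(\<Sum>q = 1..R. character_sum a {M + 1..M + int N} q) \<le> c * ln (2 * real R) * G R * Z"
      unfolding Z_def c_def G_def by (rule less.IH[OF R(2) RN R(1)])
    also have "\<dots> \<le> c * ln (real Q) * G Q * Z"
    proof (intro mult_right_mono mult_mono mult_left_mono)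
      have "2 * real R \<le> real Q" using R(3) by linarith
      then show "ln (2 * real R) \<le> ln (real Q)" using R(1) by simp
      show "G R \<le> G Q" using R(2) by (simp add: G_def mult_left_mono power_mono)
      show "0 \<le> ln (2 * real R)" using R(1) by (intro ln_ge_zero) simp
    qed (use c G Z less.prems(2) in \<open>auto intro!: mult_nonneg_nonneg\<close>)
    finally have "(\<Sum>q = 1..R. character_sum a {M + 1..M + int N} q) \<le> c * ln (real Q) * G Q * Z" .
    moreover have "(\<Sum>q = 1..Q. character_sum a {M + 1..M + int N} q)
       = (\<Sum>q = 1..R. character_sum a {M + 1..M + int N} q)
         + (\<Sum>q\<in>{R<..Q}. character_sum a {M + 1..M + int N} q)"
      using R by (subst sum.union_disjoint[symmetric]) (auto intro: sum.cong)
    ultimately have "(\<Sum>q = 1..Q. character_sum a {M + 1..M + int N} q)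
       \<le> c * ln (real Q) * G Q * Z + c * ln 2 * G Q * Z"
      using block by (simp add: R_def)
    also have "\<dots> = c * ln (2 * real Q) * G Q * Z"
      using less.prems(2) by (simp add: ln_mult algebra_simps)
    finally show ?thesis by (simp add: Z_def c_def G_def)
  qed
qed

theorem corollary1:
  "\<forall>\<epsilon>::real. \<epsilon> > 0 \<longrightarrow>
     (\<exists>C::real. C > 0 \<and>
       (\<forall>(a :: int \<Rightarrow> complex) (Q :: nat) (M :: int) (N :: int). Q > 0 \<longrightarrow> N > 0 \<longrightarrow>
          (\<Sum>q = 1..Q. real q / real (totient q) *
             (\<Sum>\<chi> | primitive_character (q\<^sup>2) \<chi>.
                (cmod (\<Sum>n = M + 1..M + N. a n * \<chi> n))\<^sup>2))
          \<le> C * ln (2 * real Q) *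
              (real Q ^ 3 +
               (real_of_int N * sqrt (real Q) + sqrt (real_of_int N) * (real Q)\<^sup>2)
                 * real_of_int N powr \<epsilon>) *
              (\<Sum>n = M + 1..M + N. (cmod (a n))\<^sup>2)))"
proof (intro allI impI)
  fix \<epsilon> :: real
  assume \<epsilon>: "\<epsilon> > 0"
  obtain C where C: "C \<ge> 1" "\<And>n. n > 0 \<Longrightarrow> real (divisor_count n) \<le> C * real n powr \<epsilon>"
    using divisor_count_le_powr[OF \<epsilon>] by blast
  \<comment> \<open>The constant of the dyadic estimate, with the divisor constant \<open>C\<close>
    included; it also exceeds what the range \<open>N \<le> Q\<^sup>2\<close> requires.\<close>
  define c where "c = 16 * (1 + 4 * pi\<^sup>2) / ln 2 * C"
  have "1 + 4 * pi\<^sup>2 > 0" by (simp add: add_pos_nonneg)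
  then have c: "c > 0" using C(1) by (simp add: c_def)
  show "\<exists>C::real. C > 0 \<and>
       (\<forall>(a :: int \<Rightarrow> complex) (Q :: nat) (M :: int) (N :: int). Q > 0 \<longrightarrow> N > 0 \<longrightarrow>
          (\<Sum>q = 1..Q. real q / real (totient q) *
             (\<Sum>\<chi> | primitive_character (q\<^sup>2) \<chi>.
                (cmod (\<Sum>n = M + 1..M + N. a n * \<chi> n))\<^sup>2))
          \<le> C * ln (2 * real Q) *
              (real Q ^ 3 +
               (real_of_int N * sqrt (real Q) + sqrt (real_of_int N) * (real Q)\<^sup>2)
                 * real_of_int N powr \<epsilon>) *
              (\<Sum>n = M + 1..M + N. (cmod (a n))\<^sup>2))"
  proof (intro exI[of _ c] conjI allI impI c)
    fix a :: "int \<Rightarrow> complex" and Q :: nat and M N' :: int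
    assume Q: "Q > 0" and "N' > 0"
    then obtain N where N': "N' = int N" and N: "N > 0" by (metis zero_less_imp_eq_int)
    define Z where "Z = (\<Sum>n = M + 1..M + int N. (cmod (a n))\<^sup>2)"
    define H where "H = (real N * sqrt (real Q) + sqrt (real N) * (real Q)\<^sup>2) * real N powr \<epsilon>"
    have Z: "Z \<ge> 0" by (simp add: Z_def sum_nonneg)
    have H: "H \<ge> 0" by (simp add: H_def)
    have lnQ: "ln 2 \<le> ln (2 * real Q)" using Q by simp
    then have ln0: "ln (2 * real Q) \<ge> 0" using ln_2_less_1 ln_gt_zero[of "2::real"] by linarith
    have "(\<Sum>q = 1..Q. character_sum a {M + 1..M + int N} q)
       \<le> c * ln (2 * real Q) * (real Q ^ 3 + H) * Z"
    proof (cases "Q\<^sup>2 < N")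
      case True
      \<comment> \<open>One bound for all \<open>n < N\<close>, by monotonicity of the power; it
        supplies the factor \<open>N powr \<epsilon>\<close>.\<close>
      define D where "D = C * real N powr \<epsilon>"
      have D1: "D \<ge> 1"
        using C(1) N \<epsilon> mult_mono[of 1 C 1 "real N powr \<epsilon>"] by (simp add: D_def ge_one_powr_ge_zero)
      have D2: "real (divisor_count n) \<le> D" if "0 < n" "n < N" for n
      proof -
        have "C * real n powr \<epsilon> \<le> D"
          unfolding D_def using that \<epsilon> C(1) by (intro mult_left_mono powr_mono2) auto
        then show ?thesis using C(2)[OF that(1)] by linarith
      qed
      have "(\<Sum>q = 1..Q. character_sum a {M + 1..M + int N} q)
         \<le> 16 * (1 + 4 * pi\<^sup>2) / ln 2 * D * ln (2 * real Q) * (real N + sqrt (real N) * (real Q)\<^sup>2) * Z"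
        unfolding Z_def by (rule character_sum_small_modulus[OF True D1 D2 Q])
      also have "\<dots> = c * ln (2 * real Q) * ((real N + sqrt (real N) * (real Q)\<^sup>2) * real N powr \<epsilon>) * Z"
        by (simp add: c_def D_def mult_ac)
      also have "\<dots> \<le> c * ln (2 * real Q) * (real Q ^ 3 + H) * Z"
      proof (intro mult_right_mono[OF mult_left_mono])
        \<comment> \<open>The dyadic estimate yields \<open>N\<close> where the claim allows
          \<open>N * sqrt Q\<close>; the two are compared through
          \<open>sqrt Q \<ge> 1\<close>.\<close>
        have "real N * 1 \<le> real N * sqrt (real Q)" using Q by (intro mult_left_mono) auto
        then have "(real N + sqrt (real N) * (real Q)\<^sup>2) * real N powr \<epsilon> \<le> H"
          unfolding H_def by (intro mult_right_mono) auto
        then show "(real N + sqrt (real N) * (real Q)\<^sup>2) * real N powr \<epsilon> \<le> real Q ^ 3 + H"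
          by (simp add: add_increasing)
      qed (use c ln0 Z in auto)
      finally show ?thesis .
    next
      case False
      have "(\<Sum>q = 1..Q. character_sum a {M + 1..M + int N} q) \<le> 4 * (1 + 4 * pi\<^sup>2) * real Q ^ 3 * Z"
        unfolding Z_def using False N by (intro character_sum_large_modulus) auto
      also have "\<dots> \<le> c * ln (2 * real Q) * (real Q ^ 3 + H) * Z"
      proof (intro mult_right_mono[OF mult_mono])
        \<comment> \<open>The logarithm is at least \<open>ln 2\<close>, which cancels the
          \<open>ln 2\<close> in the denominator of \<open>c\<close>.\<close>
        have "4 * (1 + 4 * pi\<^sup>2) * 1 \<le> 16 * (1 + 4 * pi\<^sup>2) * C"
          using C(1) by (intro mult_mono) auto
        also have "\<dots> = c * ln 2" by (simp add: c_def)
        also have "\<dots> \<le> c * ln (2 * real Q)" using lnQ c by simp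
        finally show "4 * (1 + 4 * pi\<^sup>2) \<le> c * ln (2 * real Q)" by simp
      qed (use c ln0 Z H in auto)
      finally show ?thesis .
    qed
    then show "(\<Sum>q = 1..Q. real q / real (totient q) *
             (\<Sum>\<chi> | primitive_character (q\<^sup>2) \<chi>.
                (cmod (\<Sum>n = M + 1..M + N'. a n * \<chi> n))\<^sup>2))
          \<le> c * ln (2 * real Q) *
              (real Q ^ 3 +
               (real_of_int N' * sqrt (real Q) + sqrt (real_of_int N') * (real Q)\<^sup>2)
                 * real_of_int N' powr \<epsilon>) *
              (\<Sum>n = M + 1..M + N'. (cmod (a n))\<^sup>2)"
      by (simp add: character_sum_def Z_def H_def N')
  qed
qed

end
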